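(* Consider a linear time-invariant dHDAE initial value problem $E\dot z=(J-R)z$, $z(t_0)=z_0$, with $E,J,R\in\mathbb R^{n,n}$, $J=-J^T$, $R=R^T\ge0$, $E=E^T\ge0$, which is in the staircase form $$E=\begin{bmatrix}E_{11}&E_{12}&0&0&0\\ E_{21}&E_{22}&0&0&0\\0&0&0&0&0\\0&0&0&0&0\\0&0&0&0&0\end{bmatrix},\quad J-R=\begin{bmatrix}J_{11}-R_{11}&J_{12}-R_{12}&J_{13}-R_{13}&J_{14}&0\\ J_{21}-R_{21}&J_{22}-R_{22}&J_{23}-R_{23}&0&0\\ J_{31}-R_{31}&J_{32}-R_{32}&J_{33}-R_{33}&0&0\\ J_{41}&0&0&0&0\\0&0&0&0&0\end{bmatrix}$$ with block sizes $n_1,n_2,n_3,n_4=n_1,n_5$ (blocks may be void), where $\begin{bmatrix}E_{11}&E_{12}\\ E_{21}&E_{22}\end{bmatrix}$ is symmetric positive definite and $J_{33}-R_{33}$ and $J_{41}=-J_{14}^T$ are nonsingular. Partition $z=(z_1,\dots,z_5)$ accordingly. Then: (i) The initial value problem is uniquely solvable (for consistent initial values) if and only if $n_5=0$. If $n_5\neq0$, then $z_5$ can be chosen arbitrarily. (ii) The pencil $\lambda E-(J-R)$ is non-regular if and only if the three coefficients $E,J,R$ have a (nontrivial) common kernel. (iii) The (Kronecker) index is zero if and only if $n_1=n_4=0$ and $n_3=0$. It is one if and only if $n_1=n_4=0$ and $n_3>0$, and otherwise the (Kronecker) index is two, if and only if $n_1=n_4>0$.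
   Context: A solution is a continuously differentiable function satisfying the equation pointwise; an initial value is consistent if the initial value problem has at least one solution. A pencil $\lambda E-A$ of square matrices is regular if $\det(\lambda_0E-A)\ne0$ for some $\lambda_0\in\mathbb C$, and non-regular otherwise. The (Kronecker) index of $\lambda E-A$ is the size of the largest nilpotent block $\mathcal N_\sigma$ (block associated with the eigenvalue $\infty$, $\lambda N-I_\sigma$ with $N$ a $\sigma\times\sigma$ nilpotent Jordan block) in its Kronecker canonical form, and it is $0$ if there is no such block, in particular if $E$ is invertible. *)

theory Defs
  imports
    "HOL-Analysis.Analysis"
    "Jordan_Normal_Form.Jordan_Normal_Form"
    "Jordan_Normal_Form.Matrix_Kernel"
begin

no_notation Finite_Cartesian_Product.vec_nth (infixl \<open>$\<close> 90)
no_notation Inner_Product.real_inner_class.inner (infix \<open>\<bullet>\<close> 70)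

subsection \<open>Linear differential-algebraic initial value problems\<close>

definition nondegenerate_interval :: "real set \<Rightarrow> bool" where
  "nondegenerate_interval I \<longleftrightarrow> is_interval I \<and> interior I \<noteq> {}"

text \<open>Vectors of variable dimension do not form a normed space type, so derivatives are
  componentwise. At an endpoint that belongs to \<open>I\<close> they are one-sided.\<close>

definition C1_with_deriv ::
    "real set \<Rightarrow> nat \<Rightarrow> (real \<Rightarrow> real vec) \<Rightarrow> (real \<Rightarrow> real vec) \<Rightarrow> bool" where
  "C1_with_deriv I n z z' \<longleftrightarrow>
     (\<forall>t\<in>I. z t \<in> carrier_vec n \<and> z' t \<in> carrier_vec n) \<and>
     (\<forall>i<n. (\<forall>t\<in>I. ((\<lambda>s. z s $ i) has_real_derivative z' t $ i) (at t within I)) \<and>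
            continuous_on I (\<lambda>t. z' t $ i))"

definition C1_fun :: "real set \<Rightarrow> nat \<Rightarrow> (real \<Rightarrow> real vec) \<Rightarrow> bool" where
  "C1_fun I n z \<longleftrightarrow> (\<exists>z'. C1_with_deriv I n z z')"

definition solves_ivp ::
    "real mat \<Rightarrow> real mat \<Rightarrow> real set \<Rightarrow> real \<Rightarrow> real vec \<Rightarrow> (real \<Rightarrow> real vec) \<Rightarrow> bool" where
  "solves_ivp E A I t0 z0 z \<longleftrightarrow>
     (\<exists>z'. C1_with_deriv I (dim_col E) z z' \<and> (\<forall>t\<in>I. E *\<^sub>v z' t = A *\<^sub>v z t)) \<and> z t0 = z0"

definition consistent_value ::
    "real mat \<Rightarrow> real mat \<Rightarrow> real set \<Rightarrow> real \<Rightarrow> real vec \<Rightarrow> bool" where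
  "consistent_value E A I t0 z0 \<longleftrightarrow> (\<exists>z. solves_ivp E A I t0 z0 z)"

text \<open>Solutions are total functions in HOL, hence they are compared on \<open>I\<close> only.\<close>

definition uniquely_solvable ::
    "real mat \<Rightarrow> real mat \<Rightarrow> real set \<Rightarrow> real \<Rightarrow> real vec \<Rightarrow> bool" where
  "uniquely_solvable E A I t0 z0 \<longleftrightarrow>
     (\<exists>z. solves_ivp E A I t0 z0 z \<and>
          (\<forall>w. solves_ivp E A I t0 z0 w \<longrightarrow> (\<forall>t\<in>I. w t = z t)))"


subsection \<open>Pencils \<open>\<lambda>E - A\<close> and their Kronecker index\<close>

definition regular_pencil :: "complex mat \<Rightarrow> complex mat \<Rightarrow> bool" where
  "regular_pencil E A \<longleftrightarrow> (\<exists>l. Determinant.det (l \<cdot>\<^sub>m E - A) \<noteq> 0)"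

datatype kronecker_block =
    L_Block nat
  | LT_Block nat
  | J_Block nat complex
  | N_Block nat

text \<open>\<open>L_Block 0\<close> is the \<open>0 \<times> 1\<close> block (a zero column of the pencil) and \<open>LT_Block 0\<close>
  the \<open>1 \<times> 0\<close> block (a zero row).\<close>

fun block_wf :: "kronecker_block \<Rightarrow> bool" where
  "block_wf (L_Block k) = True"
| "block_wf (LT_Block k) = True"
| "block_wf (J_Block k a) = (k > 0)"
| "block_wf (N_Block k) = (k > 0)"

text \<open>A block is the pencil \<open>\<lambda> block_E b - block_A b\<close>.\<close>

fun block_E :: "kronecker_block \<Rightarrow> complex mat" where
  "block_E (L_Block k) = mat k (k + 1) (\<lambda>(i, j). if j = i then 1 else 0)"
| "block_E (LT_Block k) = mat (k + 1) k (\<lambda>(i, j). if i = j then 1 else 0)"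
| "block_E (J_Block k a) = 1\<^sub>m k"
| "block_E (N_Block k) = jordan_block k 0"

fun block_A :: "kronecker_block \<Rightarrow> complex mat" where
  "block_A (L_Block k) = mat k (k + 1) (\<lambda>(i, j). if j = i + 1 then 1 else 0)"
| "block_A (LT_Block k) = mat (k + 1) k (\<lambda>(i, j). if i = j + 1 then 1 else 0)"
| "block_A (J_Block k a) = jordan_block k a"
| "block_A (N_Block k) = 1\<^sub>m k"

definition kronecker_canonical_form ::
    "complex mat \<Rightarrow> complex mat \<Rightarrow> kronecker_block list \<Rightarrow> bool" where
  "kronecker_canonical_form E A bs \<longleftrightarrow>
     (\<forall>b\<in>set bs. block_wf b) \<and>
     (\<exists>S T. S \<in> carrier_mat (dim_row E) (dim_row E) \<and> invertible_mat S \<and>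
            T \<in> carrier_mat (dim_col E) (dim_col E) \<and> invertible_mat T \<and>
            S * E * T = diag_block_mat (map block_E bs) \<and>
            S * A * T = diag_block_mat (map block_A bs))"

text \<open>By Kronecker's theorem a canonical form exists and is unique up to the order of the blocks,
  so the description below determines exactly one number.\<close>

definition kronecker_index :: "complex mat \<Rightarrow> complex mat \<Rightarrow> nat" where
  "kronecker_index E A =
     (THE \<nu>. \<exists>bs. kronecker_canonical_form E A bs \<and>
                  \<nu> = Max (insert 0 {\<sigma>. N_Block \<sigma> \<in> set bs}))"

abbreviation complex_mat :: "real mat \<Rightarrow> complex mat" where
  "complex_mat \<equiv> map_mat complex_of_real"


subsection \<open>Definiteness and the staircase form\<close>

definition pos_semidef :: "real mat \<Rightarrow> bool" where
  "pos_semidef M \<longleftrightarrow> (\<forall>x \<in> carrier_vec (dim_col M). x \<bullet> (M *\<^sub>v x) \<ge> 0)"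

definition pos_def :: "real mat \<Rightarrow> bool" where
  "pos_def M \<longleftrightarrow> (\<forall>x \<in> carrier_vec (dim_col M). x \<noteq> 0\<^sub>v (dim_col M) \<longrightarrow> x \<bullet> (M *\<^sub>v x) > 0)"

text \<open>The \<open>(i, j)\<close> block, counted from 1, of a square matrix whose rows and columns are both
  partitioned according to the list of sizes \<open>ns\<close>.\<close>

definition blk :: "nat list \<Rightarrow> 'a mat \<Rightarrow> nat \<Rightarrow> nat \<Rightarrow> 'a mat" where
  "blk ns M i j = mat (ns ! (i - 1)) (ns ! (j - 1))
     (\<lambda>(a, b). M $$ (sum_list (take (i - 1) ns) + a, sum_list (take (j - 1) ns) + b))"

definition has_blocks :: "nat list \<Rightarrow> 'a mat \<Rightarrow> 'a mat list list \<Rightarrow> bool" where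
  "has_blocks ns M B \<longleftrightarrow>
     M \<in> carrier_mat (sum_list ns) (sum_list ns) \<and>
     (\<forall>i\<in>{1..length ns}. \<forall>j\<in>{1..length ns}. blk ns M i j = B ! (i - 1) ! (j - 1))"

definition staircase_form ::
    "nat \<Rightarrow> nat \<Rightarrow> nat \<Rightarrow> nat \<Rightarrow> nat \<Rightarrow> real mat \<Rightarrow> real mat \<Rightarrow> real mat \<Rightarrow> bool" where
  "staircase_form n1 n2 n3 n4 n5 E J R \<longleftrightarrow>
    (let ns = [n1, n2, n3, n4, n5];
         Eb = blk ns E; Jb = blk ns J; Rb = blk ns R
     in
       has_blocks ns E
        [[Eb 1 1,     Eb 1 2,     0\<^sub>m n1 n3, 0\<^sub>m n1 n4, 0\<^sub>m n1 n5],
         [Eb 2 1,     Eb 2 2,     0\<^sub>m n2 n3, 0\<^sub>m n2 n4, 0\<^sub>m n2 n5],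
         [0\<^sub>m n3 n1, 0\<^sub>m n3 n2, 0\<^sub>m n3 n3, 0\<^sub>m n3 n4, 0\<^sub>m n3 n5],
         [0\<^sub>m n4 n1, 0\<^sub>m n4 n2, 0\<^sub>m n4 n3, 0\<^sub>m n4 n4, 0\<^sub>m n4 n5],
         [0\<^sub>m n5 n1, 0\<^sub>m n5 n2, 0\<^sub>m n5 n3, 0\<^sub>m n5 n4, 0\<^sub>m n5 n5]] \<and>
       has_blocks ns (J - R)
        [[Jb 1 1 - Rb 1 1, Jb 1 2 - Rb 1 2, Jb 1 3 - Rb 1 3, Jb 1 4,     0\<^sub>m n1 n5],
         [Jb 2 1 - Rb 2 1, Jb 2 2 - Rb 2 2, Jb 2 3 - Rb 2 3, 0\<^sub>m n2 n4, 0\<^sub>m n2 n5],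
         [Jb 3 1 - Rb 3 1, Jb 3 2 - Rb 3 2, Jb 3 3 - Rb 3 3, 0\<^sub>m n3 n4, 0\<^sub>m n3 n5],
         [Jb 4 1,          0\<^sub>m n4 n2,      0\<^sub>m n4 n3,      0\<^sub>m n4 n4, 0\<^sub>m n4 n5],
         [0\<^sub>m n5 n1,      0\<^sub>m n5 n2,      0\<^sub>m n5 n3,      0\<^sub>m n5 n4, 0\<^sub>m n5 n5]] \<and>
       pos_def (four_block_mat (Eb 1 1) (Eb 1 2) (Eb 2 1) (Eb 2 2)) \<and>
       invertible_mat (Jb 3 3 - Rb 3 3) \<and>
       invertible_mat (Jb 4 1) \<and> Jb 4 1 = - (Jb 1 4)\<^sup>T)"

end

theory Submission
  imports Defs "Jordan_Normal_Form.Jordan_Normal_Form_Existence"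
begin

text \<open>
  Put \<open>A = J - R\<close>. If \<open>E x = A x\<close> for a real vector \<open>x\<close>, then
  \<open>x \<bullet> E x + x \<bullet> R x = x \<bullet> J x = 0\<close>, so semidefiniteness forces \<open>E x = R x = 0\<close> and hence
  \<open>J x = 0\<close> (\<open>dissipative_kernel\<close>). Therefore \<open>E - A\<close> is nonsingular unless the three coefficients
  have a common kernel, which is statement (ii), and in the staircase form a common kernel vector
  lives in the last \<open>n5\<close> coordinates (\<open>kernel_E_A\<close>).

  Statement (i). The last \<open>n5\<close> rows and columns of \<open>E\<close> and \<open>A\<close> vanish, so the last component of a
  solution can be exchanged at will; if \<open>n5 > 0\<close>, uniqueness fails. If \<open>n5 = 0\<close>, the matrix
  \<open>E - A\<close> is invertible, and \<open>E u' = A u\<close> is equivalent to \<open>M u' = M u - u\<close> with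
  \<open>M = (E - A)\<^sup>-\<^sup>1 E\<close>. After a complex triangularisation of \<open>M\<close>, back substitution leaves scalar
  equations \<open>b w' = b w - w\<close> with \<open>w(t\<^sub>0) = 0\<close>, whose only solution is zero
  (\<open>scalar_dae_zero\<close>, \<open>regular_dae_zero\<close>).

  Statement (iii). Two things are needed, since the index is defined through a Kronecker canonical
  form: that a canonical form exists, and how to read off the index without knowing it. For a
  regular pencil with \<open>C = \<mu>E - A\<close> invertible, the Jordan form of \<open>C\<^sup>-\<^sup>1 E\<close> splits the pencil into
  pencils \<open>\<lambda>K - (\<mu>K - 1)\<close> with Jordan blocks \<open>K\<close>; multiplying by \<open>K\<^sup>-\<^sup>1\<close> or, if \<open>K\<close> is nilpotent, by
  \<open>(\<mu>K - 1)\<^sup>-\<^sup>1\<close>, gives pencils one of whose coefficients is the identity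
  (\<open>has_kcf_regular_pencil\<close>). The staircase pencil is the direct sum of a regular pencil and a zero
  pencil.

  The index is measured by chains \<open>x\<^sub>0, \<dots>, x\<^sub>k\<close> with \<open>E x\<^sub>0 = 0\<close> and \<open>E x\<^sub>i\<^sub>+\<^sub>1 = A x\<^sub>i\<close>. Such a chain is
  called dead if \<open>x\<^sub>0\<close> is not the beginning of any infinite chain. The existence of a dead chain
  with \<open>k\<close> steps is invariant under equivalence, and it holds for a direct sum if and only if it
  holds for one of the summands. A nilpotent block of size \<open>\<sigma>\<close> has a dead chain with \<open>k\<close> steps if
  and only if \<open>k < \<sigma>\<close>; the other blocks have none, because their \<open>E\<close> is injective or surjective.
  So \<open>k\<close> is less than the index if and only if there is a dead chain with \<open>k\<close> steps
  (\<open>less_kronecker_index_iff\<close>). In the staircase form the dead chains are found by hand: zero steps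
  are possible if and only if \<open>n1 > 0\<close> or \<open>n3 > 0\<close>, one step if and only if \<open>n1 > 0\<close>, and two steps
  never.
\<close>

section \<open>Equivalence of matrix pencils\<close>

lemma invertible_mat_iff_inverse:
  assumes "A \<in> carrier_mat n n"
  shows "invertible_mat A \<longleftrightarrow> (\<exists>B\<in>carrier_mat n n. A * B = 1\<^sub>m n \<and> B * A = 1\<^sub>m n)"
proof
  assume "invertible_mat A"
  then obtain B where B: "A * B = 1\<^sub>m (dim_row A)" "B * A = 1\<^sub>m (dim_row B)"
    unfolding invertible_mat_def inverts_mat_def by auto
  have "dim_col (A * B) = n" "dim_col (B * A) = dim_row B"
    using B assms by auto
  then have "B \<in> carrier_mat n n" using assms by auto
  then show "\<exists>B\<in>carrier_mat n n. A * B = 1\<^sub>m n \<and> B * A = 1\<^sub>m n"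
    using B assms by auto
next
  assume "\<exists>B\<in>carrier_mat n n. A * B = 1\<^sub>m n \<and> B * A = 1\<^sub>m n"
  then show "invertible_mat A"
    using assms unfolding invertible_mat_def inverts_mat_def by auto
qed

lemma invertible_mat_inverseE:
  assumes "A \<in> carrier_mat n n" "invertible_mat A"
  obtains B where "B \<in> carrier_mat n n" "A * B = 1\<^sub>m n" "B * A = 1\<^sub>m n" "invertible_mat B"
  using assms invertible_mat_iff_inverse by metis

lemma invertible_mat_iff_det:
  fixes A :: "'a::field mat"
  assumes "A \<in> carrier_mat n n"
  shows "invertible_mat A \<longleftrightarrow> Determinant.det A \<noteq> 0"
proof
  assume "invertible_mat A"
  then obtain B where B: "B \<in> carrier_mat n n" "A * B = 1\<^sub>m n"
    using assms invertible_mat_iff_inverse by blast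
  then have "Determinant.det A * Determinant.det B = 1"
    using det_mult[OF assms B(1)] by simp
  then show "Determinant.det A \<noteq> 0" by auto
next
  assume "Determinant.det A \<noteq> 0"
  then have "A \<in> Units (ring_mat TYPE('a) n ())" by (rule det_non_zero_imp_unit[OF assms])
  then show "invertible_mat A"
    using invertible_mat_iff_inverse[OF assms] by (auto simp: Units_def ring_mat_def)
qed

lemma invertible_mat_mult:
  fixes A B :: "'a::field mat"
  assumes "A \<in> carrier_mat n n" "B \<in> carrier_mat n n" "invertible_mat A" "invertible_mat B"
  shows "invertible_mat (A * B)"
  using assms invertible_mat_iff_det[of "A * B" n] invertible_mat_iff_det[of A n]
    invertible_mat_iff_det[of B n] det_mult[of A n B] by auto

lemma mult_block_diag:
  assumes "A1 \<in> carrier_mat r1 k1" "A2 \<in> carrier_mat r2 k2"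
    "B1 \<in> carrier_mat k1 c1" "B2 \<in> carrier_mat k2 c2"
  shows "four_block_mat A1 (0\<^sub>m r1 k2) (0\<^sub>m r2 k1) A2 * four_block_mat B1 (0\<^sub>m k1 c2) (0\<^sub>m k2 c1) B2
    = four_block_mat (A1 * B1) (0\<^sub>m r1 c2) (0\<^sub>m r2 c1) (A2 * B2)"
proof -
  have [simp]: "dim_row (A1 * B1) = r1" "dim_col (A1 * B1) = c1"
    "dim_row (A2 * B2) = r2" "dim_col (A2 * B2) = c2"
    using assms by auto
  show ?thesis
    using assms
    by (subst mult_four_block_mat[of _ r1 k1 _ k2 _ r2 _ _ c1 _ c2])
       (auto simp: left_add_zero_mat[of _ r2 c2] right_add_zero_mat[of _ r1 c1]
         right_mult_zero_mat[of _ r1 k1] right_mult_zero_mat[of _ r2 k2])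
qed

lemma invertible_block_diag:
  assumes "A \<in> carrier_mat n n" "B \<in> carrier_mat m m" "invertible_mat A" "invertible_mat B"
  shows "invertible_mat (four_block_mat A (0\<^sub>m n m) (0\<^sub>m m n) B)"
proof -
  obtain A' where A': "A' \<in> carrier_mat n n" "A * A' = 1\<^sub>m n" "A' * A = 1\<^sub>m n"
    using assms invertible_mat_inverseE by metis
  obtain B' where B': "B' \<in> carrier_mat m m" "B * B' = 1\<^sub>m m" "B' * B = 1\<^sub>m m"
    using assms invertible_mat_inverseE by metis
  let ?M = "four_block_mat A (0\<^sub>m n m) (0\<^sub>m m n) B"
  let ?M' = "four_block_mat A' (0\<^sub>m n m) (0\<^sub>m m n) B'"
  have "?M * ?M' = 1\<^sub>m (n + m)" "?M' * ?M = 1\<^sub>m (n + m)"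
    using assms A' B' by (auto simp: mult_block_diag)
  moreover have "?M \<in> carrier_mat (n + m) (n + m)" "?M' \<in> carrier_mat (n + m) (n + m)"
    using assms A' B' by auto
  ultimately show ?thesis using invertible_mat_iff_inverse by blast
qed

text \<open>Strict equivalence of the pencils \<open>\<lambda>E - A\<close> and \<open>\<lambda>E' - A'\<close>: one pair of invertible matrices
  transforms both coefficients. The dimensions are read off \<open>E\<close>; the pencils need not be square.\<close>

definition pencil_equiv ::
    "'a::semiring_1 mat \<Rightarrow> 'a mat \<Rightarrow> 'a mat \<Rightarrow> 'a mat \<Rightarrow> bool" where
  "pencil_equiv E A E' A' \<longleftrightarrow>
     (\<exists>S T. S \<in> carrier_mat (dim_row E) (dim_row E) \<and> invertible_mat S \<and>
            T \<in> carrier_mat (dim_col E) (dim_col E) \<and> invertible_mat T \<and>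
            S * E * T = E' \<and> S * A * T = A')"

lemma kronecker_canonical_form_iff:
  "kronecker_canonical_form E A bs \<longleftrightarrow> (\<forall>b\<in>set bs. block_wf b) \<and>
     pencil_equiv E A (diag_block_mat (map block_E bs)) (diag_block_mat (map block_A bs))"
  unfolding kronecker_canonical_form_def pencil_equiv_def by blast

lemma pencil_equivI:
  assumes "E \<in> carrier_mat r c"
    "S \<in> carrier_mat r r" "invertible_mat S" "T \<in> carrier_mat c c" "invertible_mat T"
    "S * E * T = E'" "S * A * T = A'"
  shows "pencil_equiv E A E' A'"
  using assms(2-) unfolding pencil_equiv_def carrier_matD[OF assms(1)] by blast

lemma pencil_equivE:
  assumes "pencil_equiv E A E' A'" "E \<in> carrier_mat r c"
  obtains S T where "S \<in> carrier_mat r r" "invertible_mat S" "T \<in> carrier_mat c c"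
    "invertible_mat T" "S * E * T = E'" "S * A * T = A'"
  using assms unfolding pencil_equiv_def carrier_matD[OF assms(2)] by blast

lemma invertible_one_mat [simp]: "invertible_mat (1\<^sub>m n)"
  by (subst invertible_mat_iff_inverse[of _ n]) auto

lemma pencil_equiv_refl:
  assumes "E \<in> carrier_mat r c" "A \<in> carrier_mat r c"
  shows "pencil_equiv E A E A"
  by (rule pencil_equivI[of _ r c "1\<^sub>m r" "1\<^sub>m c"]) (use assms in auto)

lemma pencil_equiv_carrier:
  assumes "pencil_equiv E A E' A'" "E \<in> carrier_mat r c" "A \<in> carrier_mat r c"
  shows "E' \<in> carrier_mat r c" "A' \<in> carrier_mat r c"
  using assms unfolding pencil_equiv_def by auto

lemma mult_sandwich_assoc:
  assumes S': "S' \<in> carrier_mat r r" and S: "S \<in> carrier_mat r r" and M: "M \<in> carrier_mat r c"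
    and T: "T \<in> carrier_mat c c" and T': "T' \<in> carrier_mat c c"
  shows "S' * (S * M * T) * T' = (S' * S) * M * (T * T')"
proof -
  have MT: "M * T \<in> carrier_mat r c" and SS: "S' * S \<in> carrier_mat r r"
    and TT: "T * T' \<in> carrier_mat c c" using assms by auto
  have "S' * (S * M * T) = (S' * S) * (M * T)"
    unfolding assoc_mult_mat[OF S M T] assoc_mult_mat[OF S' S MT] ..
  then have "S' * (S * M * T) * T' = (S' * S) * (M * (T * T'))"
    using assoc_mult_mat[OF SS MT T'] assoc_mult_mat[OF M T T'] by simp
  then show ?thesis using assoc_mult_mat[OF SS M TT] by simp
qed

lemma pencil_equiv_sym:
  assumes "pencil_equiv E A E' A'" "E \<in> carrier_mat r c" "A \<in> carrier_mat r c"
  shows "pencil_equiv E' A' E A"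
proof -
  obtain S T where S: "S \<in> carrier_mat r r" "invertible_mat S"
    and T: "T \<in> carrier_mat c c" "invertible_mat T"
    and eq: "S * E * T = E'" "S * A * T = A'"
    using pencil_equivE[OF assms(1) assms(2)] by metis
  obtain S' where S': "S' \<in> carrier_mat r r" "S * S' = 1\<^sub>m r" "S' * S = 1\<^sub>m r" "invertible_mat S'"
    using S by (rule invertible_mat_inverseE)
  obtain T' where T': "T' \<in> carrier_mat c c" "T * T' = 1\<^sub>m c" "T' * T = 1\<^sub>m c" "invertible_mat T'"
    using T by (rule invertible_mat_inverseE)
  have cancel: "S' * (S * M * T) * T' = M" if M: "M \<in> carrier_mat r c" for M
  proof -
    have "S' * (S * M * T) * T' = (S' * S) * M * (T * T')"
      by (rule mult_sandwich_assoc[OF S'(1) S(1) M T(1) T'(1)])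
    then show ?thesis using M S' T' by simp
  qed
  show ?thesis
    using pencil_equiv_carrier(1)[OF assms] S'(1,4) T'(1,4) cancel[OF assms(2)] cancel[OF assms(3)]
    unfolding eq by (rule pencil_equivI)
qed

lemma pencil_equiv_trans:
  fixes E :: "'a::field mat"
  assumes "pencil_equiv E A E' A'" "pencil_equiv E' A' E'' A''"
    "E \<in> carrier_mat r c" "A \<in> carrier_mat r c"
  shows "pencil_equiv E A E'' A''"
proof -
  note carrier' = pencil_equiv_carrier[OF assms(1,3,4)]
  obtain S T where S: "S \<in> carrier_mat r r" "invertible_mat S"
    and T: "T \<in> carrier_mat c c" "invertible_mat T"
    and eq: "S * E * T = E'" "S * A * T = A'"
    using pencil_equivE[OF assms(1) assms(3)] by metis
  obtain S' T' where S': "S' \<in> carrier_mat r r" "invertible_mat S'"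
    and T': "T' \<in> carrier_mat c c" "invertible_mat T'"
    and eq': "S' * E' * T' = E''" "S' * A' * T' = A''"
    using pencil_equivE[OF assms(2) carrier'(1)] by metis
  have assoc: "S' * (S * M * T) * T' = (S' * S) * M * (T * T')" if "M \<in> carrier_mat r c" for M
    by (rule mult_sandwich_assoc[OF S'(1) S(1) that T(1) T'(1)])
  show ?thesis
  proof (rule pencil_equivI[OF assms(3), of "S' * S" "T * T'"])
    show "invertible_mat (S' * S)" "invertible_mat (T * T')"
      using S S' T T' invertible_mat_mult by blast+
    show "(S' * S) * E * (T * T') = E''" "(S' * S) * A * (T * T') = A''"
      using assoc[OF assms(3)] assoc[OF assms(4)] unfolding eq eq' by simp_all
  qed (use S S' T T' in auto)
qed

lemma pencil_equiv_left:
  fixes E :: "'a::comm_ring_1 mat"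
  assumes "E \<in> carrier_mat r c" "A \<in> carrier_mat r c" "S \<in> carrier_mat r r" "invertible_mat S"
  shows "pencil_equiv E A (S * E) (S * A)"
  by (rule pencil_equivI[of _ r c S "1\<^sub>m c"]) (use assms in auto)

lemma pencil_equiv_block_diag:
  assumes "pencil_equiv E1 A1 E1' A1'" "pencil_equiv E2 A2 E2' A2'"
    "E1 \<in> carrier_mat r1 c1" "A1 \<in> carrier_mat r1 c1"
    "E2 \<in> carrier_mat r2 c2" "A2 \<in> carrier_mat r2 c2"
  shows "pencil_equiv
     (four_block_mat E1 (0\<^sub>m r1 c2) (0\<^sub>m r2 c1) E2) (four_block_mat A1 (0\<^sub>m r1 c2) (0\<^sub>m r2 c1) A2)
     (four_block_mat E1' (0\<^sub>m r1 c2) (0\<^sub>m r2 c1) E2') (four_block_mat A1' (0\<^sub>m r1 c2) (0\<^sub>m r2 c1) A2')"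
proof -
  obtain S1 T1 where 1: "S1 \<in> carrier_mat r1 r1" "invertible_mat S1"
     "T1 \<in> carrier_mat c1 c1" "invertible_mat T1" "S1 * E1 * T1 = E1'" "S1 * A1 * T1 = A1'"
    using pencil_equivE[OF assms(1,3)] by metis
  obtain S2 T2 where 2: "S2 \<in> carrier_mat r2 r2" "invertible_mat S2"
     "T2 \<in> carrier_mat c2 c2" "invertible_mat T2" "S2 * E2 * T2 = E2'" "S2 * A2 * T2 = A2'"
    using pencil_equivE[OF assms(2,5)] by metis
  let ?S = "four_block_mat S1 (0\<^sub>m r1 r2) (0\<^sub>m r2 r1) S2"
  let ?T = "four_block_mat T1 (0\<^sub>m c1 c2) (0\<^sub>m c2 c1) T2"
  show ?thesis
  proof (rule pencil_equivI[of _ "r1 + r2" "c1 + c2" ?S ?T])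
    show "invertible_mat ?S" "invertible_mat ?T"
      using 1(1-4) 2(1-4) by (auto intro: invertible_block_diag)
    have SE: "S1 * E1 \<in> carrier_mat r1 c1" "S2 * E2 \<in> carrier_mat r2 c2"
      and SA: "S1 * A1 \<in> carrier_mat r1 c1" "S2 * A2 \<in> carrier_mat r2 c2"
      using assms(3-6) 1(1) 2(1) by auto
    show "?S * four_block_mat E1 (0\<^sub>m r1 c2) (0\<^sub>m r2 c1) E2 * ?T =
        four_block_mat E1' (0\<^sub>m r1 c2) (0\<^sub>m r2 c1) E2'"
      unfolding mult_block_diag[OF 1(1) 2(1) assms(3,5)] mult_block_diag[OF SE 1(3) 2(3)] 1(5) 2(5) ..
    show "?S * four_block_mat A1 (0\<^sub>m r1 c2) (0\<^sub>m r2 c1) A2 * ?T =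
        four_block_mat A1' (0\<^sub>m r1 c2) (0\<^sub>m r2 c1) A2'"
      unfolding mult_block_diag[OF 1(1) 2(1) assms(4,6)] mult_block_diag[OF SA 1(3) 2(3)] 1(6) 2(6) ..
  qed (use assms(3-6) 1(1-4) 2(1-4) in auto)
qed

section \<open>Existence of the Kronecker canonical form\<close>

text \<open>The pencil \<open>\<lambda>E - A\<close> has a Kronecker canonical form.\<close>

definition has_kcf :: "complex mat \<Rightarrow> complex mat \<Rightarrow> bool" where
  "has_kcf E A \<longleftrightarrow> (\<exists>bs. kronecker_canonical_form E A bs)"

lemma has_kcf_pencil_equiv:
  assumes "pencil_equiv E A E' A'" "has_kcf E' A'" "E \<in> carrier_mat r c" "A \<in> carrier_mat r c"
  shows "has_kcf E A"
  using assms pencil_equiv_trans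
  unfolding has_kcf_def kronecker_canonical_form_iff by metis

lemma dim_block [simp]:
  "dim_row (block_A b) = dim_row (block_E b)" "dim_col (block_A b) = dim_col (block_E b)"
  by (cases b; simp)+

lemma dim_diag_block_E_A:
  "dim_row (diag_block_mat (map block_A bs)) = dim_row (diag_block_mat (map block_E bs))"
  "dim_col (diag_block_mat (map block_A bs)) = dim_col (diag_block_mat (map block_E bs))"
  by (auto simp: dim_diag_block_mat comp_def)

lemma has_kcf_block_diag:
  assumes "has_kcf E1 A1" "has_kcf E2 A2"
    "E1 \<in> carrier_mat r1 c1" "A1 \<in> carrier_mat r1 c1"
    "E2 \<in> carrier_mat r2 c2" "A2 \<in> carrier_mat r2 c2"
  shows "has_kcf
     (four_block_mat E1 (0\<^sub>m r1 c2) (0\<^sub>m r2 c1) E2) (four_block_mat A1 (0\<^sub>m r1 c2) (0\<^sub>m r2 c1) A2)"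
proof -
  obtain bs1 where 1: "\<forall>b\<in>set bs1. block_wf b"
     "pencil_equiv E1 A1 (diag_block_mat (map block_E bs1)) (diag_block_mat (map block_A bs1))"
    using assms unfolding has_kcf_def kronecker_canonical_form_iff by auto
  obtain bs2 where 2: "\<forall>b\<in>set bs2. block_wf b"
     "pencil_equiv E2 A2 (diag_block_mat (map block_E bs2)) (diag_block_mat (map block_A bs2))"
    using assms unfolding has_kcf_def kronecker_canonical_form_iff by auto
  note c1 = pencil_equiv_carrier[OF 1(2) assms(3,4)]
  note c2 = pencil_equiv_carrier[OF 2(2) assms(5,6)]
  have "kronecker_canonical_form
     (four_block_mat E1 (0\<^sub>m r1 c2) (0\<^sub>m r2 c1) E2) (four_block_mat A1 (0\<^sub>m r1 c2) (0\<^sub>m r2 c1) A2)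
     (bs1 @ bs2)"
    unfolding kronecker_canonical_form_iff map_append diag_block_mat_append Let_def
    using pencil_equiv_block_diag[OF 1(2) 2(2) assms(3-6)] 1(1) 2(1) c1 c2
    by auto
  then show ?thesis unfolding has_kcf_def by blast
qed

lemma similar_jordan_matrixE:
  fixes B :: "complex mat"
  assumes "B \<in> carrier_mat n n"
  obtains n_as P Q where "0 \<notin> fst ` set n_as" "P \<in> carrier_mat n n" "Q \<in> carrier_mat n n"
    "P * Q = 1\<^sub>m n" "Q * P = 1\<^sub>m n" "jordan_matrix n_as \<in> carrier_mat n n"
    "Q * B * P = jordan_matrix n_as" "char_poly B = (\<Prod>(k, a)\<leftarrow>n_as. [:- a, 1:] ^ k)"
proof -
  obtain as where "char_poly B = (\<Prod>a\<leftarrow>as. [:- a, 1:])" using char_poly_factorized[OF assms] by blast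
  then obtain n_as where jnf: "jordan_nf B n_as" using jordan_nf_exists[OF assms] by blast
  then obtain P Q where "similar_mat_wit B (jordan_matrix n_as) P Q"
    unfolding jordan_nf_def similar_mat_def by auto
  from similar_mat_witD2[OF assms this]
  have *: "P * Q = 1\<^sub>m n" "Q * P = 1\<^sub>m n" "B = P * jordan_matrix n_as * Q"
    "jordan_matrix n_as \<in> carrier_mat n n" "P \<in> carrier_mat n n" "Q \<in> carrier_mat n n" by auto
  have "Q * B * P = (Q * P) * jordan_matrix n_as * (Q * P)"
    unfolding *(3) by (rule mult_sandwich_assoc[OF *(6,5,4,6,5)])
  also have "\<dots> = jordan_matrix n_as"
    unfolding *(2) using *(4) by (metis left_mult_one_mat right_mult_one_mat)
  finally have "Q * B * P = jordan_matrix n_as" .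
  then show thesis
    using that * jnf jordan_nf_char_poly[OF jnf] unfolding jordan_nf_def by blast
qed

lemma diag_block_mat_finite_blocks:
  "diag_block_mat (map block_E (map (\<lambda>(k, a). J_Block k a) n_as)) = 1\<^sub>m (sum_list (map fst n_as))"
  "diag_block_mat (map block_A (map (\<lambda>(k, a). J_Block k a) n_as)) = jordan_matrix n_as"
  by (induction n_as) (auto simp: jordan_matrix_def Let_def dim_diag_block_mat)

lemma has_kcf_identity_left:
  assumes "B \<in> carrier_mat n n"
  shows "has_kcf (1\<^sub>m n) B"
proof -
  obtain n_as P Q where *: "0 \<notin> fst ` set n_as" "P \<in> carrier_mat n n" "Q \<in> carrier_mat n n"
    "P * Q = 1\<^sub>m n" "Q * P = 1\<^sub>m n" "jordan_matrix n_as \<in> carrier_mat n n"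
    "Q * B * P = jordan_matrix n_as"
    using similar_jordan_matrixE[OF assms] by metis
  have n: "sum_list (map fst n_as) = n" using *(6) jordan_matrix_dim(1)[of n_as] by auto
  have inv: "invertible_mat P" "invertible_mat Q"
    using * invertible_mat_iff_inverse by blast+
  have "pencil_equiv (1\<^sub>m n) B (1\<^sub>m n) (jordan_matrix n_as)"
    by (rule pencil_equivI[of _ n n Q P]) (use * inv in auto)
  moreover have "block_wf b" if "b \<in> set (map (\<lambda>(k, a). J_Block k a) n_as)" for b
    using that *(1) by force
  ultimately have "kronecker_canonical_form (1\<^sub>m n) B (map (\<lambda>(k, a). J_Block k a) n_as)"
    unfolding kronecker_canonical_form_iff diag_block_mat_finite_blocks n by blast
  then show ?thesis unfolding has_kcf_def by blast
qed

lemma diag_block_mat_infinite_blocks: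
  assumes "\<forall>(k, a)\<in>set n_as. a = 0"
  shows "diag_block_mat (map block_E (map (\<lambda>(k, a). N_Block k) n_as)) = jordan_matrix n_as"
  "diag_block_mat (map block_A (map (\<lambda>(k, a). N_Block k) n_as)) = 1\<^sub>m (sum_list (map fst n_as))"
  using assms by (induction n_as) (auto simp: jordan_matrix_def Let_def dim_diag_block_mat)

text \<open>Here \<open>B\<close> has no eigenvalue but \<open>0\<close>, so that its Jordan blocks are nilpotent.\<close>

lemma has_kcf_identity_right:
  assumes B: "B \<in> carrier_mat n n" and nil: "\<And>a. a \<noteq> 0 \<Longrightarrow> Determinant.det (B - a \<cdot>\<^sub>m 1\<^sub>m n) \<noteq> 0"
  shows "has_kcf B (1\<^sub>m n)"
proof -
  obtain n_as P Q where *: "0 \<notin> fst ` set n_as" "P \<in> carrier_mat n n" "Q \<in> carrier_mat n n"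
    "P * Q = 1\<^sub>m n" "Q * P = 1\<^sub>m n" "jordan_matrix n_as \<in> carrier_mat n n"
    "Q * B * P = jordan_matrix n_as" "char_poly B = (\<Prod>(k, a)\<leftarrow>n_as. [:- a, 1:] ^ k)"
    using similar_jordan_matrixE[OF assms(1)] by metis
  have n: "sum_list (map fst n_as) = n" using *(6) jordan_matrix_dim(1)[of n_as] by auto
  have inv: "invertible_mat P" "invertible_mat Q"
    using * invertible_mat_iff_inverse by blast+
  have zero: "\<forall>(k, a)\<in>set n_as. a = 0"
  proof safe
    fix k a assume ka: "(k, a) \<in> set n_as"
    then have "k \<noteq> 0" using *(1) by force
    then have "poly (char_poly B) a = 0"
      unfolding *(8) poly_prod_list prod_list_zero_iff using ka by force
    then have "eigenvalue B a" using eigenvalue_root_char_poly[OF B] by blast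
    then obtain v where v: "v \<in> carrier_vec n" "v \<noteq> 0\<^sub>v n" "B *\<^sub>v v = a \<cdot>\<^sub>v v"
      unfolding eigenvalue_def eigenvector_def using B by auto
    have "(B - a \<cdot>\<^sub>m 1\<^sub>m n) *\<^sub>v v = 0\<^sub>v n"
      using v B by (subst minus_mult_distrib_mat_vec[of _ n n]) auto
    then show "a = 0"
      using v(1,2) nil det_0_iff_vec_prod_zero_field[of "B - a \<cdot>\<^sub>m 1\<^sub>m n" n] B
      by (meson minus_carrier_mat one_carrier_mat smult_carrier_mat)
  qed
  have "pencil_equiv B (1\<^sub>m n) (jordan_matrix n_as) (1\<^sub>m n)"
    by (rule pencil_equivI[of _ n n Q P]) (use * B inv in auto)
  moreover have "block_wf b" if "b \<in> set (map (\<lambda>(k, a). N_Block k) n_as)" for b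
    using that *(1) by force
  ultimately have "kronecker_canonical_form B (1\<^sub>m n) (map (\<lambda>(k, a). N_Block k) n_as)"
    unfolding kronecker_canonical_form_iff diag_block_mat_infinite_blocks[OF zero] n by blast
  then show ?thesis unfolding has_kcf_def by blast
qed

lemma det_jordan_block_affine:
  fixes a :: "'a::field"
  shows "Determinant.det (c \<cdot>\<^sub>m jordan_block k a + d \<cdot>\<^sub>m 1\<^sub>m k) = (c * a + d) ^ k"
proof -
  let ?M = "c \<cdot>\<^sub>m jordan_block k a + d \<cdot>\<^sub>m 1\<^sub>m k"
  have "diag_mat ?M = replicate k (c * a + d)"
    by (rule nth_equalityI) (auto simp: diag_mat_def)
  moreover have "upper_triangular ?M" by auto
  ultimately show ?thesis
    using det_upper_triangular[of ?M k] by (simp add: prod_list_replicate)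
qed

text \<open>The pencil \<open>\<lambda>J - (\<mu>J - 1)\<close> for one Jordan block \<open>J\<close>: it has a purely finite spectrum if
  \<open>J\<close> is invertible, and only the eigenvalue \<open>\<infinity>\<close> if \<open>J\<close> is nilpotent.\<close>

lemma has_kcf_shifted_jordan_block:
  "has_kcf (jordan_block k a) (\<mu> \<cdot>\<^sub>m jordan_block k a - 1\<^sub>m k)"
proof -
  let ?J = "jordan_block k a"
  let ?A = "\<mu> \<cdot>\<^sub>m ?J - 1\<^sub>m k"
  have J: "?J \<in> carrier_mat k k" and A: "?A \<in> carrier_mat k k" by auto
  show ?thesis
  proof (cases "a = 0")
    case False
    have "Determinant.det ?J = a ^ k"
    proof -
      have "1 \<cdot>\<^sub>m ?J + 0 \<cdot>\<^sub>m 1\<^sub>m k = ?J" by (rule eq_matI) auto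
      then show ?thesis using det_jordan_block_affine[of 1 k a 0] by simp
    qed
    then have "invertible_mat ?J" using False invertible_mat_iff_det[OF J] by simp
    then obtain K where K: "K \<in> carrier_mat k k" "?J * K = 1\<^sub>m k" "K * ?J = 1\<^sub>m k" "invertible_mat K"
      using invertible_mat_inverseE[OF J] by metis
    have "pencil_equiv ?J ?A (K * ?J) (K * ?A)" by (rule pencil_equiv_left[OF J A K(1,4)])
    moreover have "has_kcf (K * ?J) (K * ?A)"
      unfolding K using K(1) A by (intro has_kcf_identity_left) auto
    ultimately show ?thesis using has_kcf_pencil_equiv J A by blast
  next
    case True
    have A_eq: "?A = \<mu> \<cdot>\<^sub>m ?J + (- 1) \<cdot>\<^sub>m 1\<^sub>m k" by (rule eq_matI) auto
    have "Determinant.det ?A = (- 1) ^ k"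
      unfolding A_eq det_jordan_block_affine using True by simp
    then have "invertible_mat ?A" using invertible_mat_iff_det[OF A] by simp
    then obtain K where K: "K \<in> carrier_mat k k" "?A * K = 1\<^sub>m k" "K * ?A = 1\<^sub>m k" "invertible_mat K"
      using invertible_mat_inverseE[OF A] by metis
    have "Determinant.det (K * ?J - b \<cdot>\<^sub>m 1\<^sub>m k) \<noteq> 0" if "b \<noteq> 0" for b
    proof -
      have bA: "b \<cdot>\<^sub>m ?A \<in> carrier_mat k k" by auto
      have "K * (?J - b \<cdot>\<^sub>m ?A) = K * ?J - b \<cdot>\<^sub>m (K * ?A)"
        unfolding mult_minus_distrib_mat[OF K(1) J bA] mult_smult_distrib[OF K(1) A] ..
      then have "K * ?J - b \<cdot>\<^sub>m 1\<^sub>m k = K * (?J - b \<cdot>\<^sub>m ?A)"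
        unfolding K(3) by simp
      also have "?J - b \<cdot>\<^sub>m ?A = (1 - b * \<mu>) \<cdot>\<^sub>m ?J + b \<cdot>\<^sub>m 1\<^sub>m k"
        by (rule eq_matI) (auto simp: algebra_simps)
      finally have "K * ?J - b \<cdot>\<^sub>m 1\<^sub>m k = K * ((1 - b * \<mu>) \<cdot>\<^sub>m ?J + b \<cdot>\<^sub>m 1\<^sub>m k)" .
      moreover have "(1 - b * \<mu>) \<cdot>\<^sub>m ?J + b \<cdot>\<^sub>m 1\<^sub>m k \<in> carrier_mat k k" by auto
      ultimately have "Determinant.det (K * ?J - b \<cdot>\<^sub>m 1\<^sub>m k) =
          Determinant.det K * Determinant.det ((1 - b * \<mu>) \<cdot>\<^sub>m ?J + b \<cdot>\<^sub>m 1\<^sub>m k)"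
        using det_mult[OF K(1)] by metis
      then show ?thesis
        unfolding det_jordan_block_affine
        using True that K(1,4) invertible_mat_iff_det by auto
    qed
    then have "has_kcf (K * ?J) (K * ?A)"
      unfolding K using K(1) J by (intro has_kcf_identity_right) auto
    moreover have "pencil_equiv ?J ?A (K * ?J) (K * ?A)" by (rule pencil_equiv_left[OF J A K(1,4)])
    ultimately show ?thesis using has_kcf_pencil_equiv J A by blast
  qed
qed

lemma has_kcf_empty: "has_kcf (0\<^sub>m 0 0) (0\<^sub>m 0 0)"
proof -
  have "kronecker_canonical_form (0\<^sub>m 0 0) (0\<^sub>m 0 0) []"
    unfolding kronecker_canonical_form_iff using pencil_equiv_refl[OF zero_carrier_mat zero_carrier_mat] by auto
  then show ?thesis unfolding has_kcf_def by blast
qed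

lemma has_kcf_shifted_jordan_matrix:
  "has_kcf (jordan_matrix n_as) (\<mu> \<cdot>\<^sub>m jordan_matrix n_as - 1\<^sub>m (sum_list (map fst n_as)))"
proof (induction n_as)
  case Nil
  have "\<mu> \<cdot>\<^sub>m 0\<^sub>m 0 0 - 1\<^sub>m 0 = 0\<^sub>m 0 0" by (rule eq_matI) auto
  then show ?case using has_kcf_empty by (simp add: jordan_matrix_def)
next
  case (Cons ka n_as)
  obtain k a where ka: "ka = (k, a)" by (cases ka)
  let ?m = "sum_list (map fst n_as)"
  have "\<mu> \<cdot>\<^sub>m jordan_matrix (ka # n_as) - 1\<^sub>m (sum_list (map fst (ka # n_as))) =
     four_block_mat (\<mu> \<cdot>\<^sub>m jordan_block k a - 1\<^sub>m k) (0\<^sub>m k ?m) (0\<^sub>m ?m k)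
       (\<mu> \<cdot>\<^sub>m jordan_matrix n_as - 1\<^sub>m ?m)"
    unfolding ka jordan_matrix_Cons by (rule eq_matI) auto
  moreover have "has_kcf (four_block_mat (jordan_block k a) (0\<^sub>m k ?m) (0\<^sub>m ?m k) (jordan_matrix n_as))
     (four_block_mat (\<mu> \<cdot>\<^sub>m jordan_block k a - 1\<^sub>m k) (0\<^sub>m k ?m) (0\<^sub>m ?m k)
       (\<mu> \<cdot>\<^sub>m jordan_matrix n_as - 1\<^sub>m ?m))"
    by (rule has_kcf_block_diag[OF has_kcf_shifted_jordan_block Cons.IH]) auto
  ultimately show ?case unfolding ka jordan_matrix_Cons by simp
qed

theorem has_kcf_regular_pencil:
  assumes E: "E \<in> carrier_mat n n" and A: "A \<in> carrier_mat n n" and "regular_pencil E A"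
  shows "has_kcf E A"
proof -
  obtain \<mu> where "Determinant.det (\<mu> \<cdot>\<^sub>m E - A) \<noteq> 0"
    using assms unfolding regular_pencil_def by blast
  moreover have C: "\<mu> \<cdot>\<^sub>m E - A \<in> carrier_mat n n" using E A by auto
  ultimately have "invertible_mat (\<mu> \<cdot>\<^sub>m E - A)" using invertible_mat_iff_det by blast
  then obtain K where K: "K \<in> carrier_mat n n" "K * (\<mu> \<cdot>\<^sub>m E - A) = 1\<^sub>m n" "invertible_mat K"
    using invertible_mat_inverseE[OF C] by metis
  obtain n_as P Q where *: "P \<in> carrier_mat n n" "Q \<in> carrier_mat n n"
    "P * Q = 1\<^sub>m n" "Q * P = 1\<^sub>m n" "jordan_matrix n_as \<in> carrier_mat n n"
    "Q * (K * E) * P = jordan_matrix n_as"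
    using similar_jordan_matrixE[of "K * E" n] K E by (metis mult_carrier_mat)
  have n: "sum_list (map fst n_as) = n" using *(5) jordan_matrix_dim(1)[of n_as] by auto
  have inv: "invertible_mat P" "invertible_mat Q"
    using * invertible_mat_iff_inverse by blast+
  have "K * A = \<mu> \<cdot>\<^sub>m (K * E) - 1\<^sub>m n"
  proof -
    have "K * (\<mu> \<cdot>\<^sub>m E - A) = \<mu> \<cdot>\<^sub>m (K * E) - K * A"
      using K E A by (simp add: mult_minus_distrib_mat[of K n n _ n] mult_smult_distrib[of K n n _ n])
    then have "1\<^sub>m n = \<mu> \<cdot>\<^sub>m (K * E) - K * A" using K by simp
    then have "(1\<^sub>m n :: complex mat) $$ (i, j) = (\<mu> \<cdot>\<^sub>m (K * E) - K * A) $$ (i, j)" for i j by simp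
    then show ?thesis
      by (intro eq_matI) (use K E A in \<open>auto simp: algebra_simps simp del: index_mult_mat(1)\<close>)
  qed
  then have "Q * (K * A) * P = \<mu> \<cdot>\<^sub>m (Q * (K * E) * P) - Q * P"
    using * K E
    by (simp add: mult_minus_distrib_mat[of Q n n _ n] minus_mult_distrib_mat[of _ n n _ _ n]
        mult_smult_distrib[of Q n n _ n] mult_smult_assoc_mat[of _ n n _ n])
  then have "Q * (K * A) * P = \<mu> \<cdot>\<^sub>m jordan_matrix n_as - 1\<^sub>m n" using * by simp
  then have "pencil_equiv (K * E) (K * A) (jordan_matrix n_as) (\<mu> \<cdot>\<^sub>m jordan_matrix n_as - 1\<^sub>m n)"
    by (intro pencil_equivI[of _ n n Q P]) (use * K E inv in auto)
  moreover have "has_kcf (jordan_matrix n_as) (\<mu> \<cdot>\<^sub>m jordan_matrix n_as - 1\<^sub>m n)"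
    using has_kcf_shifted_jordan_matrix[of n_as \<mu>] unfolding n .
  moreover have "K * E \<in> carrier_mat n n" "K * A \<in> carrier_mat n n" using K(1) E A by auto
  ultimately have "has_kcf (K * E) (K * A)" by (rule has_kcf_pencil_equiv)
  then show ?thesis
    using has_kcf_pencil_equiv pencil_equiv_left[OF E A K(1,3)] E A by blast
qed

lemma diag_block_mat_zero_blocks:
  "diag_block_mat (map f (replicate k b)) = 0\<^sub>m (k * r) (k * c)" if "f b = 0\<^sub>m r c"
  using that by (induction k) auto

text \<open>A zero pencil consists of one \<open>L_Block 0\<close> for each column and one \<open>LT_Block 0\<close> for each row.\<close>

lemma has_kcf_zero: "has_kcf (0\<^sub>m r c) (0\<^sub>m r c)"
proof -
  let ?bs = "replicate c (L_Block 0) @ replicate r (LT_Block 0)"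
  have zero: "block_E (L_Block 0) = 0\<^sub>m 0 1" "block_A (L_Block 0) = 0\<^sub>m 0 1"
    "block_E (LT_Block 0) = 0\<^sub>m 1 0" "block_A (LT_Block 0) = 0\<^sub>m 1 0"
    by (auto intro!: eq_matI)
  have "diag_block_mat (map block_E ?bs) = 0\<^sub>m r c" "diag_block_mat (map block_A ?bs) = 0\<^sub>m r c"
    unfolding map_append diag_block_mat_append Let_def
      diag_block_mat_zero_blocks[of block_E "L_Block 0", OF zero(1)]
      diag_block_mat_zero_blocks[of block_A "L_Block 0", OF zero(2)]
      diag_block_mat_zero_blocks[of block_E "LT_Block 0", OF zero(3)]
      diag_block_mat_zero_blocks[of block_A "LT_Block 0", OF zero(4)]
    by auto
  then have "kronecker_canonical_form (0\<^sub>m r c) (0\<^sub>m r c) ?bs"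
    unfolding kronecker_canonical_form_iff using pencil_equiv_refl[OF zero_carrier_mat zero_carrier_mat] by (auto simp del: map_append)
  then show ?thesis unfolding has_kcf_def by blast
qed

section \<open>Dead chains and the Kronecker index\<close>

text \<open>The vector \<open>v\<close> is the beginning of an infinite chain \<open>E x\<^sub>i\<^sub>+\<^sub>1 = A x\<^sub>i\<close>.\<close>

definition prolongable :: "'a::semiring_0 mat \<Rightarrow> 'a mat \<Rightarrow> 'a vec \<Rightarrow> bool" where
  "prolongable E A v \<longleftrightarrow>
     (\<exists>x. x 0 = v \<and> (\<forall>i. x i \<in> carrier_vec (dim_col E)) \<and> (\<forall>i. E *\<^sub>v x (Suc i) = A *\<^sub>v x i))"

text \<open>There is a chain of \<open>k\<close> steps that begins in the kernel of \<open>E\<close> with a vector that is not the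
  beginning of an infinite chain. Only \<open>x\<^sub>0, \<dots>, x\<^sub>k\<close> matter; the sequence is total, and its other
  members are arbitrary vectors.\<close>

definition dead_chain :: "'a::semiring_0 mat \<Rightarrow> 'a mat \<Rightarrow> nat \<Rightarrow> bool" where
  "dead_chain E A k \<longleftrightarrow>
     (\<exists>x. (\<forall>i. x i \<in> carrier_vec (dim_col E)) \<and> E *\<^sub>v x 0 = 0\<^sub>v (dim_row E) \<and>
          (\<forall>i<k. E *\<^sub>v x (Suc i) = A *\<^sub>v x i) \<and> \<not> prolongable E A (x 0))"

lemma prolongableI:
  assumes "x 0 = v" "\<And>i. x i \<in> carrier_vec c" "\<And>i. E *\<^sub>v x (Suc i) = A *\<^sub>v x i" "E \<in> carrier_mat r c"
  shows "prolongable E A v"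
  using assms unfolding prolongable_def by auto

lemma prolongableE:
  assumes "prolongable E A v" "E \<in> carrier_mat r c"
  obtains x where "x 0 = v" "\<And>i. x i \<in> carrier_vec c" "\<And>i. E *\<^sub>v x (Suc i) = A *\<^sub>v x i"
  using assms unfolding prolongable_def by auto

lemma dead_chainI:
  assumes "\<And>i. x i \<in> carrier_vec c" "E *\<^sub>v x 0 = 0\<^sub>v r" "\<And>i. i < k \<Longrightarrow> E *\<^sub>v x (Suc i) = A *\<^sub>v x i"
    "\<not> prolongable E A (x 0)" "E \<in> carrier_mat r c"
  shows "dead_chain E A k"
  using assms unfolding dead_chain_def by auto

lemma dead_chainE:
  assumes "dead_chain E A k" "E \<in> carrier_mat r c"
  obtains x where "\<And>i. x i \<in> carrier_vec c" "E *\<^sub>v x 0 = 0\<^sub>v r"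
    "\<And>i. i < k \<Longrightarrow> E *\<^sub>v x (Suc i) = A *\<^sub>v x i" "\<not> prolongable E A (x 0)"
  using assms unfolding dead_chain_def by auto

lemma mult_mat_vec_zero [simp]:
  fixes M :: "'a::semiring_0 mat"
  shows "M \<in> carrier_mat r c \<Longrightarrow> M *\<^sub>v 0\<^sub>v c = 0\<^sub>v r"
  by (rule eq_vecI) auto

lemma prolongable_kernel:
  assumes "E \<in> carrier_mat r c" "A \<in> carrier_mat r c" "v \<in> carrier_vec c" "A *\<^sub>v v = 0\<^sub>v r"
  shows "prolongable E A v"
  by (rule prolongableI[of "\<lambda>i. if i = 0 then v else 0\<^sub>v c"]) (use assms in auto)

lemma prolongable_zero:
  assumes "E \<in> carrier_mat r c" "A \<in> carrier_mat r c"
  shows "prolongable E A (0\<^sub>v c)"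
  by (rule prolongable_kernel[OF assms zero_carrier_vec mult_mat_vec_zero[OF assms(2)]])

text \<open>An equivalence of pencils carries chains to chains.\<close>

lemma pencil_equiv_chain:
  fixes E :: "'a::field mat"
  assumes eq: "pencil_equiv E A E' A'" and E: "E \<in> carrier_mat r c" and A: "A \<in> carrier_mat r c"
  obtains T T' where "T \<in> carrier_mat c c" "T' \<in> carrier_mat c c" "T * T' = 1\<^sub>m c" "T' * T = 1\<^sub>m c"
    "\<And>u v. u \<in> carrier_vec c \<Longrightarrow> v \<in> carrier_vec c \<Longrightarrow>
       E' *\<^sub>v u = A' *\<^sub>v v \<longleftrightarrow> E *\<^sub>v (T *\<^sub>v u) = A *\<^sub>v (T *\<^sub>v v)"
proof -
  obtain S T where S: "S \<in> carrier_mat r r" "invertible_mat S"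
    and T: "T \<in> carrier_mat c c" "invertible_mat T"
    and E': "S * E * T = E'" and A': "S * A * T = A'"
    using pencil_equivE[OF eq E] by metis
  obtain S' where S': "S' \<in> carrier_mat r r" "S' * S = 1\<^sub>m r"
    using S by (rule invertible_mat_inverseE)
  obtain T' where T': "T' \<in> carrier_mat c c" "T * T' = 1\<^sub>m c" "T' * T = 1\<^sub>m c"
    using T by (rule invertible_mat_inverseE)
  have cancel: "S *\<^sub>v u = S *\<^sub>v v \<longleftrightarrow> u = v" if "u \<in> carrier_vec r" "v \<in> carrier_vec r" for u v
  proof
    assume "S *\<^sub>v u = S *\<^sub>v v"
    then have "(S' * S) *\<^sub>v u = (S' * S) *\<^sub>v v"
      using that S(1) S'(1) by (simp add: assoc_mult_mat_vec[of _ r r _ r])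
    then show "u = v" using that S'(2) by simp
  qed simp
  have move: "S * M * T *\<^sub>v u = S *\<^sub>v (M *\<^sub>v (T *\<^sub>v u))"
    if M: "M \<in> carrier_mat r c" and u: "u \<in> carrier_vec c" for M u
  proof -
    have SM: "S * M \<in> carrier_mat r c" and Tu: "T *\<^sub>v u \<in> carrier_vec c" using S(1) T(1) M u by auto
    show ?thesis
      unfolding assoc_mult_mat_vec[OF SM T(1) u] assoc_mult_mat_vec[OF S(1) M Tu] ..
  qed
  have "E' *\<^sub>v u = A' *\<^sub>v v \<longleftrightarrow> E *\<^sub>v (T *\<^sub>v u) = A *\<^sub>v (T *\<^sub>v v)"
    if u: "u \<in> carrier_vec c" and v: "v \<in> carrier_vec c" for u v
    unfolding E'[symmetric] A'[symmetric] move[OF E u] move[OF A v]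
    by (rule cancel) (use E A T(1) u v in auto)
  then show thesis using that T(1) T' by blast
qed

lemma dead_chain_pencil_equiv_imp:
  fixes E :: "'a::field mat"
  assumes eq: "pencil_equiv E A E' A'" and E: "E \<in> carrier_mat r c" and A: "A \<in> carrier_mat r c"
    and dead: "dead_chain E' A' k"
  shows "dead_chain E A k"
proof -
  note E' = pencil_equiv_carrier(1)[OF eq E A] and A' = pencil_equiv_carrier(2)[OF eq E A]
  obtain T T' where T: "T \<in> carrier_mat c c" "T' \<in> carrier_mat c c" "T * T' = 1\<^sub>m c" "T' * T = 1\<^sub>m c"
    and iff: "\<And>u v. u \<in> carrier_vec c \<Longrightarrow> v \<in> carrier_vec c \<Longrightarrow>
       E' *\<^sub>v u = A' *\<^sub>v v \<longleftrightarrow> E *\<^sub>v (T *\<^sub>v u) = A *\<^sub>v (T *\<^sub>v v)"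
    using pencil_equiv_chain[OF eq E A] by metis
  have TT': "T *\<^sub>v (T' *\<^sub>v u) = u" and T'T: "T' *\<^sub>v (T *\<^sub>v u) = u" if "u \<in> carrier_vec c" for u
    using assoc_mult_mat_vec[OF T(1,2) that] assoc_mult_mat_vec[OF T(2,1) that] T(3,4) that by simp_all
  obtain x where x: "\<And>i. x i \<in> carrier_vec c" "E' *\<^sub>v x 0 = 0\<^sub>v r"
    "\<And>i. i < k \<Longrightarrow> E' *\<^sub>v x (Suc i) = A' *\<^sub>v x i" "\<not> prolongable E' A' (x 0)"
    using dead E' by (rule dead_chainE) blast
  show ?thesis
  proof (rule dead_chainI[OF _ _ _ _ E])
    show "T *\<^sub>v x i \<in> carrier_vec c" for i using T(1) x(1) by auto
    show "E *\<^sub>v (T *\<^sub>v x 0) = 0\<^sub>v r"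
      using iff[of "x 0" "0\<^sub>v c"] x(1,2) T(1) A A' by simp
    show "E *\<^sub>v (T *\<^sub>v x (Suc i)) = A *\<^sub>v (T *\<^sub>v x i)" if "i < k" for i
      using iff x(1) x(3)[OF that] by blast
    show "\<not> prolongable E A (T *\<^sub>v x 0)"
    proof
      assume "prolongable E A (T *\<^sub>v x 0)"
      then obtain y where y: "y 0 = T *\<^sub>v x 0" "\<And>i. y i \<in> carrier_vec c"
        "\<And>i. E *\<^sub>v y (Suc i) = A *\<^sub>v y i" using E by (rule prolongableE) blast
      have "prolongable E' A' (x 0)"
      proof (rule prolongableI[OF _ _ _ E'])
        show "T' *\<^sub>v y 0 = x 0" unfolding y(1) using T'T x(1) .
        show "T' *\<^sub>v y i \<in> carrier_vec c" for i using T(2) y(2) by auto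
        then show "E' *\<^sub>v (T' *\<^sub>v y (Suc i)) = A' *\<^sub>v (T' *\<^sub>v y i)" for i
          using iff TT'[OF y(2)] y(3) by simp
      qed
      then show False using x(4) by blast
    qed
  qed
qed

lemma dead_chain_pencil_equiv:
  fixes E :: "'a::field mat"
  assumes "pencil_equiv E A E' A'" "E \<in> carrier_mat r c" "A \<in> carrier_mat r c"
  shows "dead_chain E A k \<longleftrightarrow> dead_chain E' A' k"
  using dead_chain_pencil_equiv_imp[OF assms] pencil_equiv_carrier[OF assms]
    dead_chain_pencil_equiv_imp[OF pencil_equiv_sym[OF assms]] by blast

lemma block_diag_mult_vec:
  assumes "M1 \<in> carrier_mat r1 c1" "M2 \<in> carrier_mat r2 c2" "a \<in> carrier_vec c1" "b \<in> carrier_vec c2"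
  shows "four_block_mat M1 (0\<^sub>m r1 c2) (0\<^sub>m r2 c1) M2 *\<^sub>v (a @\<^sub>v b) = (M1 *\<^sub>v a) @\<^sub>v (M2 *\<^sub>v b)"
proof -
  have "0\<^sub>m r1 c2 *\<^sub>v b = 0\<^sub>v r1" "0\<^sub>m r2 c1 *\<^sub>v a = 0\<^sub>v r2" using assms by auto
  moreover have "M1 *\<^sub>v a \<in> carrier_vec r1" "M2 *\<^sub>v b \<in> carrier_vec r2" using assms by auto
  ultimately show ?thesis
    using four_block_mat_mult_vec[OF assms(1) zero_carrier_mat zero_carrier_mat assms(2-4)] by simp
qed

context
  fixes E1 A1 E2 A2 E A :: "'a::semiring_0 mat" and r1 c1 r2 c2 :: nat
  assumes E1: "E1 \<in> carrier_mat r1 c1" and A1: "A1 \<in> carrier_mat r1 c1"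
    and E2: "E2 \<in> carrier_mat r2 c2" and A2: "A2 \<in> carrier_mat r2 c2"
  defines E_def: "E \<equiv> four_block_mat E1 (0\<^sub>m r1 c2) (0\<^sub>m r2 c1) E2"
    and A_def: "A \<equiv> four_block_mat A1 (0\<^sub>m r1 c2) (0\<^sub>m r2 c1) A2"
begin

lemma block_diag_carrier: "E \<in> carrier_mat (r1 + r2) (c1 + c2)"
  unfolding E_def using E1 E2 by auto

lemma block_diag_chain_iff:
  assumes "a \<in> carrier_vec c1" "b \<in> carrier_vec c2" "a' \<in> carrier_vec c1" "b' \<in> carrier_vec c2"
  shows "E *\<^sub>v (a @\<^sub>v b) = A *\<^sub>v (a' @\<^sub>v b') \<longleftrightarrow> E1 *\<^sub>v a = A1 *\<^sub>v a' \<and> E2 *\<^sub>v b = A2 *\<^sub>v b'"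
proof -
  have "E1 *\<^sub>v a \<in> carrier_vec r1" "A1 *\<^sub>v a' \<in> carrier_vec r1" using E1 A1 assms by auto
  then show ?thesis
    unfolding E_def A_def using block_diag_mult_vec[OF E1 E2 assms(1,2)]
      block_diag_mult_vec[OF A1 A2 assms(3,4)] append_vec_eq by metis
qed

lemma block_diag_kernel_iff:
  assumes "a \<in> carrier_vec c1" "b \<in> carrier_vec c2"
  shows "E *\<^sub>v (a @\<^sub>v b) = 0\<^sub>v (r1 + r2) \<longleftrightarrow> E1 *\<^sub>v a = 0\<^sub>v r1 \<and> E2 *\<^sub>v b = 0\<^sub>v r2"
proof -
  have "E1 *\<^sub>v a \<in> carrier_vec r1" "0\<^sub>v (r1 + r2) = (0\<^sub>v r1 @\<^sub>v 0\<^sub>v r2 :: 'a vec)" using E1 assms by auto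
  then show ?thesis
    unfolding E_def using block_diag_mult_vec[OF E1 E2 assms(1,2)] append_vec_eq zero_carrier_vec by metis
qed

lemma prolongable_block_diag_iff:
  assumes a: "a \<in> carrier_vec c1" and b: "b \<in> carrier_vec c2"
  shows "prolongable E A (a @\<^sub>v b) \<longleftrightarrow> prolongable E1 A1 a \<and> prolongable E2 A2 b"
proof safe
  assume "prolongable E A (a @\<^sub>v b)"
  then obtain x where x: "x 0 = a @\<^sub>v b" "\<And>i. x i \<in> carrier_vec (c1 + c2)"
    "\<And>i. E *\<^sub>v x (Suc i) = A *\<^sub>v x i"
    using block_diag_carrier by (rule prolongableE) blast
  define y z where "y i = vec_first (x i) c1" and "z i = vec_last (x i) c2" for i
  have yz: "x i = y i @\<^sub>v z i" "y i \<in> carrier_vec c1" "z i \<in> carrier_vec c2" for i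
    using vec_first_last_append[OF x(2), of i] unfolding y_def z_def by auto
  have "E1 *\<^sub>v y (Suc i) = A1 *\<^sub>v y i \<and> E2 *\<^sub>v z (Suc i) = A2 *\<^sub>v z i" for i
    using x(3)[of i] block_diag_chain_iff[OF yz(2,3,2,3)] unfolding yz(1) by blast
  moreover have "y 0 = a" "z 0 = b"
    using x(1) append_vec_eq[OF a yz(2)[of 0], of b "z 0"] unfolding yz(1) by auto
  ultimately show "prolongable E1 A1 a" "prolongable E2 A2 b"
    using prolongableI[of y, OF _ yz(2) _ E1] prolongableI[of z, OF _ yz(3) _ E2] by simp_all
next
  assume "prolongable E1 A1 a"
  then obtain y where y: "y 0 = a" "\<And>i. y i \<in> carrier_vec c1" "\<And>i. E1 *\<^sub>v y (Suc i) = A1 *\<^sub>v y i"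
    using E1 by (rule prolongableE) blast
  assume "prolongable E2 A2 b"
  then obtain z where z: "z 0 = b" "\<And>i. z i \<in> carrier_vec c2" "\<And>i. E2 *\<^sub>v z (Suc i) = A2 *\<^sub>v z i"
    using E2 by (rule prolongableE) blast
  show "prolongable E A (a @\<^sub>v b)"
    by (rule prolongableI[of "\<lambda>i. y i @\<^sub>v z i", OF _ _ _ block_diag_carrier])
       (use y z block_diag_chain_iff in auto)
qed

lemma dead_chain_block_diag: "dead_chain E A k \<longleftrightarrow> dead_chain E1 A1 k \<or> dead_chain E2 A2 k"
proof
  assume "dead_chain E A k"
  then obtain x where x: "\<And>i. x i \<in> carrier_vec (c1 + c2)" "E *\<^sub>v x 0 = 0\<^sub>v (r1 + r2)"
    "\<And>i. i < k \<Longrightarrow> E *\<^sub>v x (Suc i) = A *\<^sub>v x i" "\<not> prolongable E A (x 0)"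
    using block_diag_carrier by (rule dead_chainE) blast
  define y z where "y i = vec_first (x i) c1" and "z i = vec_last (x i) c2" for i
  have yz: "x i = y i @\<^sub>v z i" "y i \<in> carrier_vec c1" "z i \<in> carrier_vec c2" for i
    using vec_first_last_append[OF x(1), of i] unfolding y_def z_def by auto
  have step: "E1 *\<^sub>v y (Suc i) = A1 *\<^sub>v y i \<and> E2 *\<^sub>v z (Suc i) = A2 *\<^sub>v z i" if "i < k" for i
    using x(3)[OF that] block_diag_chain_iff[OF yz(2,3,2,3)] unfolding yz(1) by blast
  have ker: "E1 *\<^sub>v y 0 = 0\<^sub>v r1 \<and> E2 *\<^sub>v z 0 = 0\<^sub>v r2"
    using x(2) block_diag_kernel_iff[OF yz(2,3)] unfolding yz(1) by blast
  have "\<not> prolongable E1 A1 (y 0) \<or> \<not> prolongable E2 A2 (z 0)"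
    using x(4) prolongable_block_diag_iff[OF yz(2,3)] unfolding yz(1) by blast
  then show "dead_chain E1 A1 k \<or> dead_chain E2 A2 k"
    using step ker dead_chainI[of y, OF yz(2) _ _ _ E1] dead_chainI[of z, OF yz(3) _ _ _ E2] by auto
next
  assume "dead_chain E1 A1 k \<or> dead_chain E2 A2 k"
  then show "dead_chain E A k"
  proof
    assume "dead_chain E1 A1 k"
    then obtain y where y: "\<And>i. y i \<in> carrier_vec c1" "E1 *\<^sub>v y 0 = 0\<^sub>v r1"
      "\<And>i. i < k \<Longrightarrow> E1 *\<^sub>v y (Suc i) = A1 *\<^sub>v y i" "\<not> prolongable E1 A1 (y 0)"
      using E1 by (rule dead_chainE) blast
    show ?thesis
    proof (rule dead_chainI[OF _ _ _ _ block_diag_carrier])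
      show car: "y i @\<^sub>v 0\<^sub>v c2 \<in> carrier_vec (c1 + c2)" for i using y(1) by auto
      show "E *\<^sub>v (y 0 @\<^sub>v 0\<^sub>v c2) = 0\<^sub>v (r1 + r2)"
        using y(2) block_diag_kernel_iff y(1) E2 A2 by simp
      show "E *\<^sub>v (y (Suc i) @\<^sub>v 0\<^sub>v c2) = A *\<^sub>v (y i @\<^sub>v 0\<^sub>v c2)" if "i < k" for i
        using y(3)[OF that] block_diag_chain_iff y(1) E2 A2 by simp
      show "\<not> prolongable E A (y 0 @\<^sub>v 0\<^sub>v c2)"
        using y(4) prolongable_block_diag_iff y(1) by simp
    qed
  next
    assume "dead_chain E2 A2 k"
    then obtain z where z: "\<And>i. z i \<in> carrier_vec c2" "E2 *\<^sub>v z 0 = 0\<^sub>v r2"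
      "\<And>i. i < k \<Longrightarrow> E2 *\<^sub>v z (Suc i) = A2 *\<^sub>v z i" "\<not> prolongable E2 A2 (z 0)"
      using E2 by (rule dead_chainE) blast
    show ?thesis
    proof (rule dead_chainI[OF _ _ _ _ block_diag_carrier])
      show car: "0\<^sub>v c1 @\<^sub>v z i \<in> carrier_vec (c1 + c2)" for i using z(1) by auto
      show "E *\<^sub>v (0\<^sub>v c1 @\<^sub>v z 0) = 0\<^sub>v (r1 + r2)"
        using z(2) block_diag_kernel_iff z(1) E1 A1 by simp
      show "E *\<^sub>v (0\<^sub>v c1 @\<^sub>v z (Suc i)) = A *\<^sub>v (0\<^sub>v c1 @\<^sub>v z i)" if "i < k" for i
        using z(3)[OF that] block_diag_chain_iff z(1) E1 A1 by simp
      show "\<not> prolongable E A (0\<^sub>v c1 @\<^sub>v z 0)"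
        using z(4) prolongable_block_diag_iff z(1) by simp
    qed
  qed
qed

end

lemma not_dead_chain_injective:
  assumes E: "E \<in> carrier_mat r c" and A: "A \<in> carrier_mat r c"
    and "\<And>v. v \<in> carrier_vec c \<Longrightarrow> E *\<^sub>v v = 0\<^sub>v r \<Longrightarrow> v = 0\<^sub>v c"
  shows "\<not> dead_chain E A k"
proof
  assume "dead_chain E A k"
  then obtain x where "\<And>i. x i \<in> carrier_vec c" "E *\<^sub>v x 0 = 0\<^sub>v r"
    "\<And>i. i < k \<Longrightarrow> E *\<^sub>v x (Suc i) = A *\<^sub>v x i" "\<not> prolongable E A (x 0)"
    using E by (rule dead_chainE) blast
  then show False using assms(3)[of "x 0"] prolongable_zero[OF E A] by auto
qed

lemma not_dead_chain_surjective:
  assumes E: "E \<in> carrier_mat r c" and A: "A \<in> carrier_mat r c"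
    and surj: "\<And>y. y \<in> carrier_vec r \<Longrightarrow> G y \<in> carrier_vec c \<and> E *\<^sub>v G y = y"
  shows "\<not> dead_chain E A k"
proof
  assume "dead_chain E A k"
  then obtain x where "\<And>i. x i \<in> carrier_vec c" "E *\<^sub>v x 0 = 0\<^sub>v r"
    "\<And>i. i < k \<Longrightarrow> E *\<^sub>v x (Suc i) = A *\<^sub>v x i" "\<not> prolongable E A (x 0)"
    using E by (rule dead_chainE) blast
  then have x: "x 0 \<in> carrier_vec c" "\<not> prolongable E A (x 0)" by auto
  define y where "y = rec_nat (x 0) (\<lambda>_ v. G (A *\<^sub>v v))"
  have y: "y 0 = x 0" "y (Suc i) = G (A *\<^sub>v y i)" for i unfolding y_def by simp_all
  have car: "y i \<in> carrier_vec c" for i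
    by (induction i) (use A x surj y in auto)
  have "prolongable E A (x 0)"
    by (rule prolongableI[of y, OF y(1) car _ E]) (use A y(2) car surj in auto)
  then show False using x by blast
qed

lemma nilpotent_block_mult_vec:
  fixes v :: "'a::semiring_1 vec"
  assumes "v \<in> carrier_vec s" "i < s"
  shows "(jordan_block s 0 *\<^sub>v v) $ i = (if Suc i < s then v $ Suc i else 0)"
proof -
  have "(jordan_block s 0 *\<^sub>v v) $ i = (\<Sum>j = 0..<s. jordan_block s 0 $$ (i, j) * v $ j)"
    using assms by (simp add: scalar_prod_def)
  also have "\<dots> = (\<Sum>j = 0..<s. if j = Suc i then v $ j else 0)"
    using assms by (intro sum.cong) auto
  finally show ?thesis by simp
qed

lemma dead_chain_nilpotent_block:
  "dead_chain (jordan_block s (0::'a::field)) (1\<^sub>m s) k \<longleftrightarrow> k < s"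
proof
  let ?N = "jordan_block s (0::'a)"
  have N: "?N \<in> carrier_mat s s" by auto
  assume "dead_chain ?N (1\<^sub>m s) k"
  then obtain x where x: "\<And>i. x i \<in> carrier_vec s" "?N *\<^sub>v x 0 = 0\<^sub>v s"
    "\<And>i. i < k \<Longrightarrow> ?N *\<^sub>v x (Suc i) = 1\<^sub>m s *\<^sub>v x i" "\<not> prolongable ?N (1\<^sub>m s) (x 0)"
    using N by (rule dead_chainE) blast
  show "k < s"
  proof (rule ccontr)
    assume k: "\<not> k < s"
    have step: "x i $ j = (if Suc j < s then x (Suc i) $ Suc j else 0)" if "i < k" "j < s" for i j
      using x(3)[OF that(1)] x(1) nilpotent_block_mult_vec[OF x(1) that(2), of "Suc i"] by simp
    have "x 0 $ j = x (s - Suc j) $ (s - 1)" if "j < s" for j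
    proof -
      have "x 0 $ j = x i $ (j + i)" if "j + i < s" for i
        using that
      proof (induction i)
        case (Suc i)
        then show ?case using step[of i "j + i"] k by auto
      qed simp
      from this[of "s - Suc j"] that show ?thesis by simp
    qed
    then have "x 0 $ j = 0" if "j < s" for j
      using step[of "s - Suc j" "s - 1"] that k by auto
    then have "x 0 = 0\<^sub>v s" using x(1)[of 0] by (intro eq_vecI) auto
    then show False using x(4) prolongable_zero[OF N] by auto
  qed
next
  let ?N = "jordan_block s (0::'a)"
  have N: "?N \<in> carrier_mat s s" by auto
  assume k: "k < s"
  have "\<not> prolongable ?N (1\<^sub>m s) (unit_vec s 0)"
  proof
    assume "prolongable ?N (1\<^sub>m s) (unit_vec s 0)"
    then obtain y where y: "y 0 = unit_vec s 0" "\<And>i. y i \<in> carrier_vec s"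
      "\<And>i. ?N *\<^sub>v y (Suc i) = 1\<^sub>m s *\<^sub>v y i" using N by (rule prolongableE) blast
    have step: "y i $ j = (if Suc j < s then y (Suc i) $ Suc j else 0)" if "j < s" for i j
      using y(3)[of i] y(2) nilpotent_block_mult_vec[OF y(2) that, of "Suc i"] by simp
    have "y i $ i = 1" if "i < s" for i
      using that
    proof (induction i)
      case (Suc i)
      then show ?case using step[of i i] by auto
    qed (simp add: y(1))
    from this[of "s - 1"] step[of "s - 1" "s - 1"] k show False by auto
  qed
  moreover have "?N *\<^sub>v unit_vec s 0 = 0\<^sub>v s"
    by (rule eq_vecI) (auto simp: nilpotent_block_mult_vec unit_vec_def simp del: index_mult_mat_vec)
  moreover have "?N *\<^sub>v unit_vec s (Suc i) = 1\<^sub>m s *\<^sub>v unit_vec s i" if "i < k" for i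
    by (rule eq_vecI) (use that k in \<open>auto simp: nilpotent_block_mult_vec unit_vec_def
      simp del: index_mult_mat_vec\<close>)
  ultimately show "dead_chain ?N (1\<^sub>m s) k"
    by (intro dead_chainI[of "unit_vec s", OF _ _ _ _ N]) auto
qed

lemma mult_mat_vec_unit_row:
  fixes M :: "'a::semiring_1 mat"
  assumes "M \<in> carrier_mat r c" "v \<in> carrier_vec c" "i < r" "l < c"
    and "\<And>j. j < c \<Longrightarrow> M $$ (i, j) = (if j = l then 1 else 0)"
  shows "(M *\<^sub>v v) $ i = v $ l"
proof -
  have "(M *\<^sub>v v) $ i = (\<Sum>j = 0..<c. M $$ (i, j) * v $ j)"
    using assms(1-3) by (simp add: scalar_prod_def)
  also have "\<dots> = (\<Sum>j = 0..<c. if j = l then v $ j else 0)"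
    using assms(5) by (intro sum.cong) auto
  finally show ?thesis using assms(4) by simp
qed

lemma dead_chain_block: "dead_chain (block_E b) (block_A b) k \<longleftrightarrow> (\<exists>s. b = N_Block s \<and> k < s)"
proof (cases b)
  case (L_Block m)
  have mult: "block_E b *\<^sub>v (y @\<^sub>v 0\<^sub>v 1) = y" if "y \<in> carrier_vec m" for y
  proof (rule eq_vecI)
    fix i assume i: "i < dim_vec y"
    have "y @\<^sub>v 0\<^sub>v 1 \<in> carrier_vec (m + 1)" using that by (intro append_carrier_vec) auto
    then have "(block_E b *\<^sub>v (y @\<^sub>v 0\<^sub>v 1)) $ i = (y @\<^sub>v 0\<^sub>v 1) $ i"
      by (intro mult_mat_vec_unit_row[of _ m "m + 1"]) (use i that L_Block in auto)
    then show "(block_E b *\<^sub>v (y @\<^sub>v 0\<^sub>v 1)) $ i = y $ i" using i by simp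
  qed (use that L_Block in auto)
  have "\<not> dead_chain (block_E b) (block_A b) k"
  proof (rule not_dead_chain_surjective[of _ m "m + 1" _ "\<lambda>y. y @\<^sub>v 0\<^sub>v 1"])
    show "y @\<^sub>v 0\<^sub>v 1 \<in> carrier_vec (m + 1) \<and> block_E b *\<^sub>v (y @\<^sub>v 0\<^sub>v 1) = y"
      if "y \<in> carrier_vec m" for y
      using mult[OF that] append_carrier_vec[OF that zero_carrier_vec] by blast
  qed (use L_Block in auto)
  then show ?thesis using L_Block by simp
next
  case (LT_Block m)
  have "v = 0\<^sub>v m" if v: "v \<in> carrier_vec m" "block_E b *\<^sub>v v = 0\<^sub>v (m + 1)" for v
  proof (rule eq_vecI)
    fix i assume i: "i < dim_vec (0\<^sub>v m :: complex vec)"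
    have "(block_E b *\<^sub>v v) $ i = v $ i"
      by (rule mult_mat_vec_unit_row[of _ "m + 1" m]) (use i v LT_Block in auto)
    then show "v $ i = 0\<^sub>v m $ i" using v(2) i by simp
  qed (use v in auto)
  then have "\<not> dead_chain (block_E b) (block_A b) k"
    by (intro not_dead_chain_injective[of _ "m + 1" m]) (use LT_Block in auto)
  then show ?thesis using LT_Block by simp
next
  case (J_Block m a)
  have "\<not> dead_chain (block_E b) (block_A b) k"
    by (rule not_dead_chain_injective[of _ m m]) (use J_Block in auto)
  then show ?thesis using J_Block by simp
next
  case (N_Block s)
  then show ?thesis using dead_chain_nilpotent_block[of s k] by auto
qed

lemma dead_chain_diag_blocks:
  "dead_chain (diag_block_mat (map block_E bs)) (diag_block_mat (map block_A bs)) k \<longleftrightarrow>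
     (\<exists>s. N_Block s \<in> set bs \<and> k < s)"
proof (induction bs)
  case Nil
  have "\<not> dead_chain (0\<^sub>m 0 0 :: complex mat) (0\<^sub>m 0 0) k"
    by (rule not_dead_chain_injective[of _ 0 0]) auto
  then show ?case by simp
next
  case (Cons b bs)
  let ?E = "diag_block_mat (map block_E bs)" and ?A = "diag_block_mat (map block_A bs)"
  note dims = dim_diag_block_E_A[of bs]
  have carrier: "block_E b \<in> carrier_mat (dim_row (block_E b)) (dim_col (block_E b))"
    "block_A b \<in> carrier_mat (dim_row (block_E b)) (dim_col (block_E b))"
    "?E \<in> carrier_mat (dim_row ?E) (dim_col ?E)" "?A \<in> carrier_mat (dim_row ?E) (dim_col ?E)"
    unfolding carrier_mat_def using dims by simp_all
  have "dead_chain (diag_block_mat (map block_E (b # bs))) (diag_block_mat (map block_A (b # bs))) k \<longleftrightarrow>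
      dead_chain (block_E b) (block_A b) k \<or> dead_chain ?E ?A k"
    unfolding list.map diag_block_mat.simps Let_def dim_block dims
    by (rule dead_chain_block_diag[OF carrier])
  then show ?case unfolding Cons.IH dead_chain_block by auto
qed

text \<open>For every canonical form of the pencil, \<open>k\<close> is less than the size of its largest nilpotent block if
  and only if there is a dead chain with \<open>k\<close> steps. So all canonical forms yield the same number, and
  the definite description in the definition of the index denotes.\<close>

theorem less_kronecker_index_iff:
  assumes "has_kcf E A" "E \<in> carrier_mat r c" "A \<in> carrier_mat r c"
  shows "k < kronecker_index E A \<longleftrightarrow> dead_chain E A k"
proof -
  let ?ix = "\<lambda>bs. Max (insert 0 {s. N_Block s \<in> set bs})"
  have ix: "k < ?ix bs \<longleftrightarrow> dead_chain E A k" if "kronecker_canonical_form E A bs" for bs k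
  proof -
    have "finite {s. N_Block s \<in> set bs}"
      using finite_vimageI[of "set bs" N_Block] by (auto simp: inj_def vimage_def)
    then have "k < ?ix bs \<longleftrightarrow> (\<exists>s. N_Block s \<in> set bs \<and> k < s)"
      by (subst Max_gr_iff) auto
    then show ?thesis
      using dead_chain_diag_blocks dead_chain_pencil_equiv assms(2,3) that
      unfolding kronecker_canonical_form_iff by blast
  qed
  obtain bs where bs: "kronecker_canonical_form E A bs" using assms(1) unfolding has_kcf_def by blast
  have "kronecker_index E A = ?ix bs"
    unfolding kronecker_index_def
  proof (rule the_equality)
    fix \<nu> assume "\<exists>bs. kronecker_canonical_form E A bs \<and> \<nu> = ?ix bs"
    then have "j < \<nu> \<longleftrightarrow> j < ?ix bs" for j using ix bs by metis
    then show "\<nu> = ?ix bs" by (meson less_irrefl linorder_neqE_nat)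
  qed (use bs in blast)
  then show ?thesis using ix[OF bs] by simp
qed

text \<open>For a real pencil, the real and the imaginary part of a complex chain are chains.\<close>

lemma complex_mat_chain_iff:
  assumes E: "E \<in> carrier_mat r c" and A: "A \<in> carrier_mat r c"
    and u: "u \<in> carrier_vec c" and v: "v \<in> carrier_vec c"
  shows "complex_mat E *\<^sub>v u = complex_mat A *\<^sub>v v \<longleftrightarrow>
     E *\<^sub>v map_vec Re u = A *\<^sub>v map_vec Re v \<and> E *\<^sub>v map_vec Im u = A *\<^sub>v map_vec Im v"
proof -
  have parts: "Re ((complex_mat M *\<^sub>v w) $ i) = (M *\<^sub>v map_vec Re w) $ i"
      "Im ((complex_mat M *\<^sub>v w) $ i) = (M *\<^sub>v map_vec Im w) $ i"
    if "M \<in> carrier_mat r c" "w \<in> carrier_vec c" "i < r" for M w i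
    using that by (auto simp: scalar_prod_def)
  show ?thesis
    unfolding vec_eq_iff complex_eq_iff
    using E A u v parts[OF E u] parts[OF A v] by auto
qed

lemma prolongable_complex_mat:
  assumes E: "E \<in> carrier_mat r c" and A: "A \<in> carrier_mat r c" and v: "v \<in> carrier_vec c"
  shows "prolongable (complex_mat E) (complex_mat A) v \<longleftrightarrow>
     prolongable E A (map_vec Re v) \<and> prolongable E A (map_vec Im v)"
proof safe
  have cE: "complex_mat E \<in> carrier_mat r c" using E by auto
  assume "prolongable (complex_mat E) (complex_mat A) v"
  then obtain x where x: "x 0 = v" "\<And>i. x i \<in> carrier_vec c"
    "\<And>i. complex_mat E *\<^sub>v x (Suc i) = complex_mat A *\<^sub>v x i" using cE by (rule prolongableE) blast
  note steps = x(3)[unfolded complex_mat_chain_iff[OF E A x(2,2)]]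
  show "prolongable E A (map_vec Re v)"
    by (rule prolongableI[of "\<lambda>i. map_vec Re (x i)", OF _ _ _ E]) (use x steps in auto)
  show "prolongable E A (map_vec Im v)"
    by (rule prolongableI[of "\<lambda>i. map_vec Im (x i)", OF _ _ _ E]) (use x steps in auto)
next
  have cE: "complex_mat E \<in> carrier_mat r c" using E by auto
  assume "prolongable E A (map_vec Re v)"
  then obtain x where x: "x 0 = map_vec Re v" "\<And>i. x i \<in> carrier_vec c"
    "\<And>i. E *\<^sub>v x (Suc i) = A *\<^sub>v x i" using E by (rule prolongableE) blast
  assume "prolongable E A (map_vec Im v)"
  then obtain y where y: "y 0 = map_vec Im v" "\<And>i. y i \<in> carrier_vec c"
    "\<And>i. E *\<^sub>v y (Suc i) = A *\<^sub>v y i" using E by (rule prolongableE) blast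
  define z where "z i = vec c (\<lambda>j. Complex (x i $ j) (y i $ j))" for i
  have z: "z i \<in> carrier_vec c" "map_vec Re (z i) = x i" "map_vec Im (z i) = y i" for i
    using x(2)[of i] y(2)[of i] by (auto simp: z_def)
  show "prolongable (complex_mat E) (complex_mat A) v"
  proof (rule prolongableI[OF _ z(1) _ cE])
    show "z 0 = v" using v x(1) y(1) by (auto simp: z_def)
    show "complex_mat E *\<^sub>v z (Suc i) = complex_mat A *\<^sub>v z i" for i
      unfolding complex_mat_chain_iff[OF E A z(1,1)] z(2,3) using x(3) y(3) by blast
  qed
qed

lemma dead_chain_complex_mat:
  assumes E: "E \<in> carrier_mat r c" and A: "A \<in> carrier_mat r c"
  shows "dead_chain (complex_mat E) (complex_mat A) k \<longleftrightarrow> dead_chain E A k"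
proof
  have cE: "complex_mat E \<in> carrier_mat r c" using E by auto
  have cA: "complex_mat A \<in> carrier_mat r c" using A by auto
  have ker: "complex_mat E *\<^sub>v u = 0\<^sub>v r \<longleftrightarrow> E *\<^sub>v map_vec Re u = 0\<^sub>v r \<and> E *\<^sub>v map_vec Im u = 0\<^sub>v r"
    if "u \<in> carrier_vec c" for u
  proof -
    have "map_vec Re (0\<^sub>v c) = 0\<^sub>v c" "map_vec Im (0\<^sub>v c) = 0\<^sub>v c" by auto
    then show ?thesis
      using complex_mat_chain_iff[OF E A that zero_carrier_vec] cA A by simp
  qed
  {
    assume "dead_chain (complex_mat E) (complex_mat A) k"
    then obtain x where x: "\<And>i. x i \<in> carrier_vec c" "complex_mat E *\<^sub>v x 0 = 0\<^sub>v r"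
      "\<And>i. i < k \<Longrightarrow> complex_mat E *\<^sub>v x (Suc i) = complex_mat A *\<^sub>v x i"
      "\<not> prolongable (complex_mat E) (complex_mat A) (x 0)"
      using cE by (rule dead_chainE) blast
    note steps = x(3)[unfolded complex_mat_chain_iff[OF E A x(1,1)]]
    have car: "map_vec Re (x i) \<in> carrier_vec c" "map_vec Im (x i) \<in> carrier_vec c" for i
      using x(1) by auto
    consider "\<not> prolongable E A (map_vec Re (x 0))" | "\<not> prolongable E A (map_vec Im (x 0))"
      using x(4) prolongable_complex_mat[OF E A x(1)] by blast
    then show "dead_chain E A k"
    proof cases
      case 1
      show ?thesis
        by (rule dead_chainI[of "\<lambda>i. map_vec Re (x i)", OF car(1) _ _ 1 E])
           (use x(2) ker[OF x(1)] steps in auto)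
    next
      case 2
      show ?thesis
        by (rule dead_chainI[of "\<lambda>i. map_vec Im (x i)", OF car(2) _ _ 2 E])
           (use x(2) ker[OF x(1)] steps in auto)
    qed
  }
  assume "dead_chain E A k"
  then obtain x where x: "\<And>i. x i \<in> carrier_vec c" "E *\<^sub>v x 0 = 0\<^sub>v r"
    "\<And>i. i < k \<Longrightarrow> E *\<^sub>v x (Suc i) = A *\<^sub>v x i" "\<not> prolongable E A (x 0)"
    using E by (rule dead_chainE) blast
  let ?z = "\<lambda>i. map_vec complex_of_real (x i)"
  have z: "?z i \<in> carrier_vec c" "map_vec Re (?z i) = x i" "map_vec Im (?z i) = 0\<^sub>v c" for i
    using x(1)[of i] by auto
  show "dead_chain (complex_mat E) (complex_mat A) k"
  proof (rule dead_chainI[of ?z, OF z(1) _ _ _ cE])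
    show "complex_mat E *\<^sub>v ?z 0 = 0\<^sub>v r" unfolding ker[OF z(1)] z(2,3) using x(2) E by simp
    show "complex_mat E *\<^sub>v ?z (Suc i) = complex_mat A *\<^sub>v ?z i" if "i < k" for i
      unfolding complex_mat_chain_iff[OF E A z(1,1)] z(2,3) using x(3)[OF that] E A by simp
    show "\<not> prolongable (complex_mat E) (complex_mat A) (?z 0)"
      unfolding prolongable_complex_mat[OF E A z(1)] z(2,3) using x(4) by blast
  qed
qed

section \<open>Uniqueness for linear differential-algebraic equations\<close>

lemma nondegenerate_interval_other_point:
  assumes "nondegenerate_interval I"
  obtains s where "s \<in> I" "s \<noteq> t"
proof -
  obtain x e where e: "e > 0" "ball x e \<subseteq> I"
    using assms unfolding nondegenerate_interval_def by (auto simp: mem_interior)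
  then have "x + e / 2 \<in> I" "x \<in> I" by (auto simp: dist_real_def intro!: subsetD[OF e(2)])
  then show thesis using that[of x] that[of "x + e / 2"] e(1) by fastforce
qed

lemma at_within_nondegenerate_interval:
  assumes "nondegenerate_interval I" "t \<in> I"
  shows "at t within I \<noteq> bot"
proof -
  have "connected I"
    using assms(1) unfolding nondegenerate_interval_def by (simp add: is_interval_connected)
  moreover have "I \<noteq> {t}" using nondegenerate_interval_other_point[OF assms(1)] by blast
  ultimately have "t islimpt I" using connected_imp_perfect[of I t] assms(2) by blast
  then show ?thesis by (simp add: trivial_limit_within)
qed

text \<open>For \<open>b = 0\<close> the equation is algebraic and for \<open>b \<noteq> 0\<close> it is an ordinary differential
  equation.\<close>

lemma scalar_dae_zero:
  fixes w w' :: "real \<Rightarrow> complex" and b \<mu> :: complex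
  assumes "convex I" "t0 \<in> I" "w t0 = 0"
    and deriv: "\<And>t. t \<in> I \<Longrightarrow> (w has_vector_derivative w' t) (at t within I)"
    and eq: "\<And>t. t \<in> I \<Longrightarrow> b * w' t = \<mu> * (b * w t) - w t"
    and t: "t \<in> I"
  shows "w t = 0"
proof (cases "b = 0")
  case True
  then show ?thesis using eq[OF t] by simp
next
  case False
  define a where "a = \<mu> - 1 / b"
  have w': "w' s = a * w s" if "s \<in> I" for s
    using eq[OF that] False by (simp add: a_def field_simps)
  define g where "g s = exp (s *\<^sub>R (- a)) * w s" for s
  have g': "(g has_vector_derivative 0) (at s within I)" if "s \<in> I" for s
  proof -
    have "(g has_vector_derivative
        exp (s *\<^sub>R (- a)) * w' s + exp (s *\<^sub>R (- a)) * (- a) * w s) (at s within I)"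
      unfolding g_def
      by (intro has_vector_derivative_mult exp_scaleR_has_vector_derivative_right deriv that)
    then show ?thesis using w'[OF that] by (simp add: algebra_simps)
  qed
  have "\<exists>c. \<forall>s\<in>I. g s = c"
    by (rule has_vector_derivative_zero_constant[OF assms(1) g']) blast+
  then obtain c where c: "\<And>s. s \<in> I \<Longrightarrow> g s = c" by blast
  then have "c = 0" using assms(2,3) unfolding g_def by force
  then show ?thesis using c[OF t] unfolding g_def by simp
qed

text \<open>The solution of a homogeneous differential-algebraic equation with a regular pencil is
  determined by its initial value.\<close>

theorem regular_dae_zero:
  fixes E A :: "real mat" and u u' :: "real \<Rightarrow> real vec"
  assumes E: "E \<in> carrier_mat n n" and A: "A \<in> carrier_mat n n"
    and reg: "invertible_mat (\<mu> \<cdot>\<^sub>m E - A)"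
    and I: "nondegenerate_interval I" "t0 \<in> I"
    and u: "C1_with_deriv I n u u'" "u t0 = 0\<^sub>v n"
    and eq: "\<And>t. t \<in> I \<Longrightarrow> E *\<^sub>v u' t = A *\<^sub>v u t"
    and t: "t \<in> I"
  shows "u t = 0\<^sub>v n"
proof -
  have car: "u t \<in> carrier_vec n" "u' t \<in> carrier_vec n" if "t \<in> I" for t
    using u(1) that unfolding C1_with_deriv_def by auto
  have C: "\<mu> \<cdot>\<^sub>m E - A \<in> carrier_mat n n" using E A by auto
  obtain K where K: "K \<in> carrier_mat n n" "K * (\<mu> \<cdot>\<^sub>m E - A) = 1\<^sub>m n"
    using C reg by (rule invertible_mat_inverseE)
  define M where "M = K * E"
  have M: "M \<in> carrier_mat n n" unfolding M_def using K E by auto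
  have Mu: "M *\<^sub>v u' t = \<mu> \<cdot>\<^sub>v (M *\<^sub>v u t) - u t" if "t \<in> I" for t
  proof -
    have Eu: "E *\<^sub>v u t \<in> carrier_vec n" "A *\<^sub>v u t \<in> carrier_vec n" using E A car[OF that] by auto
    have "(\<mu> \<cdot>\<^sub>m E - A) *\<^sub>v u t = (\<mu> \<cdot>\<^sub>m E) *\<^sub>v u t - A *\<^sub>v u t"
      using E A car[OF that] by (intro minus_mult_distrib_mat_vec[of _ n n]) auto
    also have "(\<mu> \<cdot>\<^sub>m E) *\<^sub>v u t = \<mu> \<cdot>\<^sub>v (E *\<^sub>v u t)"
      using E car[OF that] by (intro eq_vecI) (auto simp: scalar_prod_def sum_distrib_left mult.assoc)
    finally have "A *\<^sub>v u t = \<mu> \<cdot>\<^sub>v (E *\<^sub>v u t) - (\<mu> \<cdot>\<^sub>m E - A) *\<^sub>v u t"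
      using Eu by auto
    then have "K *\<^sub>v (A *\<^sub>v u t) = K *\<^sub>v (\<mu> \<cdot>\<^sub>v (E *\<^sub>v u t)) - K *\<^sub>v ((\<mu> \<cdot>\<^sub>m E - A) *\<^sub>v u t)"
      using K(1) Eu C car[OF that] by (simp add: mult_minus_distrib_mat_vec[of _ n n])
    also have "K *\<^sub>v (\<mu> \<cdot>\<^sub>v (E *\<^sub>v u t)) = \<mu> \<cdot>\<^sub>v (M *\<^sub>v u t)"
      unfolding M_def assoc_mult_mat_vec[OF K(1) E car(1)[OF that]] by (rule mult_mat_vec[OF K(1) Eu(1)])
    also have "K *\<^sub>v ((\<mu> \<cdot>\<^sub>m E - A) *\<^sub>v u t) = u t"
      unfolding assoc_mult_mat_vec[OF K(1) C car(1)[OF that], symmetric] K(2) using car[OF that] by simp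
    finally have "K *\<^sub>v (A *\<^sub>v u t) = \<mu> \<cdot>\<^sub>v (M *\<^sub>v u t) - u t" .
    then show ?thesis
      unfolding eq[OF that, symmetric] assoc_mult_mat_vec[OF K(1) E car(2)[OF that], symmetric] M_def .
  qed
  \<comment> \<open>Over the complex numbers \<open>M\<close> can be triangularised.\<close>
  have cM: "complex_mat M \<in> carrier_mat n n" using M by auto
  obtain as where "char_poly (complex_mat M) = (\<Prod>a\<leftarrow>as. [:- a, 1:])"
    using char_poly_factorized[OF cM] by blast
  then obtain B where B: "B \<in> carrier_mat n n" "upper_triangular B" "similar_mat (complex_mat M) B"
    using schur_decomposition_exists[OF cM] by blast
  then obtain P Q where "similar_mat_wit (complex_mat M) B P Q" unfolding similar_mat_def by blast
  from similar_mat_witD2[OF cM this]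
  have PQ: "P \<in> carrier_mat n n" "Q \<in> carrier_mat n n" "P * Q = 1\<^sub>m n" "Q * P = 1\<^sub>m n"
    and MPQ: "complex_mat M = P * B * Q" by auto
  have QM: "B * Q = Q * complex_mat M"
  proof -
    have "Q * (P * B * Q) = (Q * P) * (B * Q)"
      using B(1) PQ(1,2) assoc_mult_mat[of P n n B n Q n] assoc_mult_mat[of Q n n P n "B * Q" n] by auto
    then show ?thesis unfolding MPQ PQ(4) using B(1) PQ(2) by simp
  qed
  define w w' where "w t = Q *\<^sub>v map_vec complex_of_real (u t)"
    and "w' t = Q *\<^sub>v map_vec complex_of_real (u' t)" for t
  have wcar: "w t \<in> carrier_vec n" "w' t \<in> carrier_vec n" if "t \<in> I" for t
    unfolding w_def w'_def using PQ car[OF that] by auto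
  have deriv: "((\<lambda>t. w t $ k) has_vector_derivative w' t $ k) (at t within I)"
    if "t \<in> I" "k < n" for t k
  proof -
    have *: "(Q *\<^sub>v map_vec complex_of_real v) $ k = (\<Sum>j = 0..<n. Q $$ (k, j) * of_real (v $ j))"
      if "v \<in> carrier_vec n" for v
      using that \<open>k < n\<close> PQ(2) by (simp add: scalar_prod_def)
    have "((\<lambda>t. \<Sum>j = 0..<n. Q $$ (k, j) * of_real (u t $ j)) has_vector_derivative
        (\<Sum>j = 0..<n. Q $$ (k, j) * of_real (u' t $ j))) (at t within I)"
    proof (intro has_vector_derivative_sum has_vector_derivative_mult_right has_vector_derivative_of_real)
      fix j assume "j \<in> {0..<n}"
      then show "((\<lambda>t. u t $ j) has_real_derivative u' t $ j) (at t within I)"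
        using u(1) that(1) unfolding C1_with_deriv_def by auto
    qed
    then show ?thesis
      unfolding w'_def *[OF car(2)[OF that(1)]]
      by (rule has_vector_derivative_transform[rotated 2]) (use that car * in \<open>auto simp: w_def\<close>)
  qed
  have Bw: "B *\<^sub>v w' t = \<mu> \<cdot>\<^sub>v (B *\<^sub>v w t) - w t" if "t \<in> I" for t
  proof -
    have BQ: "B *\<^sub>v (Q *\<^sub>v map_vec complex_of_real v) = Q *\<^sub>v map_vec complex_of_real (M *\<^sub>v v)"
      if v: "v \<in> carrier_vec n" for v
    proof -
      have cv: "map_vec complex_of_real v \<in> carrier_vec n" using v by auto
      show ?thesis
        unfolding assoc_mult_mat_vec[OF B(1) PQ(2) cv, symmetric] QM
          assoc_mult_mat_vec[OF PQ(2) cM cv] of_real_hom.mult_mat_vec_hom[OF M v] ..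
    qed
    have Mcar: "M *\<^sub>v u t \<in> carrier_vec n" using M car[OF that] by auto
    have "map_vec complex_of_real (\<mu> \<cdot>\<^sub>v (M *\<^sub>v u t) - u t) =
        \<mu> \<cdot>\<^sub>v map_vec complex_of_real (M *\<^sub>v u t) - map_vec complex_of_real (u t)"
      using M Mcar car[OF that] by (intro eq_vecI) auto
    then show ?thesis
      unfolding w_def w'_def BQ[OF car(1)[OF that]] BQ[OF car(2)[OF that]] Mu[OF that]
      using PQ(2) Mcar car[OF that]
      by (simp add: mult_minus_distrib_mat_vec[of _ n n] mult_mat_vec[of _ n n])
  qed
  have "convex I" using I(1) unfolding nondegenerate_interval_def by (simp add: is_interval_convex)
  \<comment> \<open>Back substitution: the components with larger index, and with them their derivatives, vanish,
    so that row \<open>k\<close> is a scalar equation for component \<open>k\<close>.\<close>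
  have "w t $ k = 0" if "k < n" "t \<in> I" for k t
    using that
  proof (induction "n - k" arbitrary: k t rule: less_induct)
    case less
    have zero: "w s $ l = 0" "w' s $ l = 0" if "k < l" "l < n" "s \<in> I" for l s
    proof -
      have wl: "w s $ l = 0" if "s \<in> I" for s
        using less(1)[of l s] \<open>k < l\<close> \<open>l < n\<close> that by auto
      then show "w s $ l = 0" using that(3) .
      have "((\<lambda>t. w t $ l) has_vector_derivative 0) (at s within I)"
        using that(3) by (rule has_vector_derivative_transform[OF _ _ has_vector_derivative_const])
          (use wl in auto)
      then show "w' s $ l = 0"
        using vector_derivative_unique_within[OF at_within_nondegenerate_interval[OF I(1) that(3)]]
          deriv[OF that(3,2)] by blast
    qed
    have row: "(B *\<^sub>v v) $ k = B $$ (k, k) * v $ k"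
      if v: "v \<in> carrier_vec n" "\<And>l. k < l \<Longrightarrow> l < n \<Longrightarrow> v $ l = 0" for v
    proof -
      have "(B *\<^sub>v v) $ k = (\<Sum>l = 0..<n. B $$ (k, l) * v $ l)"
        using v(1) less(2) B(1) by (simp add: scalar_prod_def)
      also have "\<dots> = (\<Sum>l\<in>{k}. B $$ (k, l) * v $ l)"
      proof (rule sum.mono_neutral_right)
        show "\<forall>l\<in>{0..<n} - {k}. B $$ (k, l) * v $ l = 0"
        proof
          fix l assume l: "l \<in> {0..<n} - {k}"
          show "B $$ (k, l) * v $ l = 0"
          proof (cases "l < k")
            case True
            then show ?thesis using upper_triangularD[OF B(2)] less(2) B(1) by simp
          qed (use l v(2)[of l] in auto)
        qed
      qed (use less(2) in auto)
      finally show ?thesis by simp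
    qed
    show ?case
    proof (rule scalar_dae_zero[OF \<open>convex I\<close> I(2) _ deriv])
      show "w t0 $ k = 0" using u(2) PQ(2) less(2) unfolding w_def by (simp add: scalar_prod_def)
      fix s assume s: "s \<in> I"
      have "(B *\<^sub>v w' s) $ k = \<mu> * (B *\<^sub>v w s) $ k - w s $ k"
        unfolding Bw[OF s] using wcar[OF s] B(1) less(2) by simp
      then show "B $$ (k, k) * w' s $ k = \<mu> * (B $$ (k, k) * w s $ k) - w s $ k"
        using row[OF wcar(1)[OF s]] row[OF wcar(2)[OF s]] zero s by simp
    qed (use less(2,3) in auto)
  qed
  then have "w t = 0\<^sub>v n" using wcar(1)[OF t] t by (intro eq_vecI) auto
  moreover have "P *\<^sub>v w t = map_vec complex_of_real (u t)"
    unfolding w_def using PQ car(1)[OF t] by (subst assoc_mult_mat_vec[symmetric, of _ n n _ n]) auto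
  ultimately have "map_vec complex_of_real (u t) = 0\<^sub>v n" using PQ(1) by simp
  then show ?thesis using car(1)[OF t] by (auto simp: vec_eq_iff)
qed

lemma regular_ivp_unique:
  assumes E: "E \<in> carrier_mat n n" and A: "A \<in> carrier_mat n n"
    and reg: "invertible_mat (\<mu> \<cdot>\<^sub>m E - A)"
    and I: "nondegenerate_interval I" "t0 \<in> I"
    and z: "solves_ivp E A I t0 z0 z" and w: "solves_ivp E A I t0 z0 w" and t: "t \<in> I"
  shows "w t = z t"
proof -
  obtain z' where z': "C1_with_deriv I n z z'" "\<And>t. t \<in> I \<Longrightarrow> E *\<^sub>v z' t = A *\<^sub>v z t" "z t0 = z0"
    using z E unfolding solves_ivp_def by auto
  obtain w' where w': "C1_with_deriv I n w w'" "\<And>t. t \<in> I \<Longrightarrow> E *\<^sub>v w' t = A *\<^sub>v w t" "w t0 = z0"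
    using w E unfolding solves_ivp_def by auto
  have car: "z t \<in> carrier_vec n" "z' t \<in> carrier_vec n" "w t \<in> carrier_vec n" "w' t \<in> carrier_vec n"
    if "t \<in> I" for t using z'(1) w'(1) that unfolding C1_with_deriv_def by auto
  have "w t - z t = 0\<^sub>v n"
  proof (rule regular_dae_zero[OF E A reg I _ _ _ t, of "\<lambda>t. w t - z t" "\<lambda>t. w' t - z' t"])
    have "((\<lambda>s. (w s - z s) $ i) has_real_derivative (w' t - z' t) $ i) (at t within I)"
      if "i < n" "t \<in> I" for i t
    proof -
      have diff: "((\<lambda>s. w s $ i - z s $ i) has_vector_derivative w' t $ i - z' t $ i) (at t within I)"
        using z'(1) w'(1) that
        unfolding C1_with_deriv_def has_real_derivative_iff_has_vector_derivative
        by (intro has_vector_derivative_diff) auto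
      have sub: "(w s - z s) $ i = w s $ i - z s $ i" if "s \<in> I" for s
        using car[OF that] \<open>i < n\<close> by simp
      have "(w' t - z' t) $ i = w' t $ i - z' t $ i" using car[OF that(2)] that(1) by simp
      then show ?thesis
        unfolding has_real_derivative_iff_has_vector_derivative
        using has_vector_derivative_transform[OF that(2) sub diff] by simp
    qed
    moreover have "continuous_on I (\<lambda>t. (w' t - z' t) $ i)" if "i < n" for i
    proof -
      have "continuous_on I (\<lambda>t. w' t $ i - z' t $ i)"
        using z'(1) w'(1) that unfolding C1_with_deriv_def by (intro continuous_on_diff) auto
      moreover have "w' t $ i - z' t $ i = (w' t - z' t) $ i" if "t \<in> I" for t
        using car[OF that] \<open>i < n\<close> by simp
      ultimately show ?thesis by (rule continuous_on_eq)
    qed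
    ultimately show "C1_with_deriv I n (\<lambda>t. w t - z t) (\<lambda>t. w' t - z' t)"
      using car unfolding C1_with_deriv_def by auto
    show "w t0 - z t0 = 0\<^sub>v n" using z'(3) w'(3) car(1)[OF I(2)] by auto
    show "E *\<^sub>v (w' t - z' t) = A *\<^sub>v (w t - z t)" if "t \<in> I" for t
      using z'(2)[OF that] w'(2)[OF that] car[OF that] E A
      by (simp add: mult_minus_distrib_mat_vec[of _ n n])
  qed
  then have "(w t - z t) $ i = 0" if "i < n" for i using that by simp
  then show ?thesis using car[OF t] by (intro eq_vecI) auto
qed

section \<open>Dissipative pencils\<close>

lemma mult_mat_vec_index_sum:
  assumes "M \<in> carrier_mat r c" "v \<in> carrier_vec c" "i < r"
  shows "(M *\<^sub>v v) $ i = (\<Sum>j = 0..<c. M $$ (i, j) * v $ j)"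
  using assms by (simp add: scalar_prod_def)

lemma minus_vec_eq_zeroD:
  fixes u v :: "'a::group_add vec"
  assumes "u \<in> carrier_vec n" "v \<in> carrier_vec n" "u - v = 0\<^sub>v n"
  shows "u = v"
proof (rule eq_vecI)
  fix i assume "i < dim_vec v"
  then have "(u - v) $ i = u $ i - v $ i" using assms(1,2) by simp
  moreover have "(u - v) $ i = 0" unfolding assms(3) using \<open>i < dim_vec v\<close> assms(2) by simp
  ultimately show "u $ i = v $ i" by simp
qed (use assms in auto)

lemma scalar_prod_transpose_mat:
  fixes M :: "'a::comm_semiring_0 mat"
  assumes "M \<in> carrier_mat r c" "x \<in> carrier_vec r" "y \<in> carrier_vec c"
  shows "x \<bullet> (M *\<^sub>v y) = y \<bullet> (M\<^sup>T *\<^sub>v x)"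
proof -
  have "x \<bullet> (M *\<^sub>v y) = (\<Sum>i = 0..<r. \<Sum>j = 0..<c. x $ i * (M $$ (i, j) * y $ j))"
    using assms by (simp add: scalar_prod_def sum_distrib_left)
  also have "\<dots> = (\<Sum>j = 0..<c. \<Sum>i = 0..<r. x $ i * (M $$ (i, j) * y $ j))" by (rule sum.swap)
  also have "\<dots> = y \<bullet> (M\<^sup>T *\<^sub>v x)"
    using assms by (simp add: scalar_prod_def sum_distrib_left ac_simps)
  finally show ?thesis .
qed

lemma skew_quadratic_form_zero:
  fixes J :: "real mat"
  assumes "J \<in> carrier_mat n n" "J = - J\<^sup>T" "x \<in> carrier_vec n"
  shows "x \<bullet> (J *\<^sub>v x) = 0"
proof -
  have "J\<^sup>T = - J" using assms(2) by (metis uminus_uminus_mat)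
  moreover have "(- J) *\<^sub>v x = - (J *\<^sub>v x)"
    using assms(1,3) by (intro eq_vecI) (auto simp: scalar_prod_def sum_negf)
  moreover have "x \<bullet> (- (J *\<^sub>v x)) = - (x \<bullet> (J *\<^sub>v x))"
    using assms(1) by (simp add: scalar_prod_def sum_negf)
  ultimately have "x \<bullet> (J *\<^sub>v x) = - (x \<bullet> (J *\<^sub>v x))"
    using scalar_prod_transpose_mat[OF assms(1,3,3)] by metis
  then show ?thesis by simp
qed

lemma psd_quadratic_form_zero:
  fixes M :: "real mat"
  assumes M: "M \<in> carrier_mat n n" and sym: "M = M\<^sup>T" and psd: "pos_semidef M"
    and x: "x \<in> carrier_vec n" and zero: "x \<bullet> (M *\<^sub>v x) = 0"
  shows "M *\<^sub>v x = 0\<^sub>v n"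
proof -
  define y where "y = M *\<^sub>v x"
  have y: "y \<in> carrier_vec n" unfolding y_def using M x by auto
  have My: "M *\<^sub>v y \<in> carrier_vec n" using M y by auto
  have quad: "(y + s \<cdot>\<^sub>v x) \<bullet> (M *\<^sub>v (y + s \<cdot>\<^sub>v x)) = y \<bullet> (M *\<^sub>v y) + 2 * s * (y \<bullet> y)" for s
  proof -
    have "M *\<^sub>v (y + s \<cdot>\<^sub>v x) = M *\<^sub>v y + s \<cdot>\<^sub>v y"
      using M x y by (simp add: mult_add_distrib_mat_vec[of _ n n] mult_mat_vec[of _ n n] y_def)
    then have "(y + s \<cdot>\<^sub>v x) \<bullet> (M *\<^sub>v (y + s \<cdot>\<^sub>v x)) =
       y \<bullet> (M *\<^sub>v y) + y \<bullet> (s \<cdot>\<^sub>v y) + ((s \<cdot>\<^sub>v x) \<bullet> (M *\<^sub>v y) + (s \<cdot>\<^sub>v x) \<bullet> (s \<cdot>\<^sub>v y))"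
      using x y My
      by (simp add: add_scalar_prod_distrib[of _ n] scalar_prod_add_distrib[of _ n] distrib_left)
    moreover have "x \<bullet> (M *\<^sub>v y) = y \<bullet> y"
      using scalar_prod_transpose_mat[OF M x y] unfolding sym[symmetric] y_def .
    moreover have "x \<bullet> y = 0" using zero unfolding y_def .
    moreover have "y \<bullet> (s \<cdot>\<^sub>v y) = s * (y \<bullet> y)" by (rule scalar_prod_smult_distrib[OF y y])
    moreover have "(s \<cdot>\<^sub>v x) \<bullet> (M *\<^sub>v y) = s * (x \<bullet> (M *\<^sub>v y))"
      by (rule smult_scalar_prod_distrib[OF x My])
    moreover have "(s \<cdot>\<^sub>v x) \<bullet> (s \<cdot>\<^sub>v y) = s * (s * (x \<bullet> y))"
      using smult_scalar_prod_distrib[OF x, of "s \<cdot>\<^sub>v y" s] scalar_prod_smult_distrib[OF x y] y by simp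
    ultimately show ?thesis by simp
  qed
  have "y \<bullet> y = 0"
  proof (rule ccontr)
    assume "y \<bullet> y \<noteq> 0"
    \<comment> \<open>the value of \<open>s\<close> at which the form, affine in \<open>s\<close>, equals \<open>-1\<close>\<close>
    define s where "s = - (y \<bullet> (M *\<^sub>v y) + 1) / (2 * (y \<bullet> y))"
    have "(y + s \<cdot>\<^sub>v x) \<bullet> (M *\<^sub>v (y + s \<cdot>\<^sub>v x)) = - 1"
      unfolding quad s_def using \<open>y \<bullet> y \<noteq> 0\<close> by (simp add: field_simps)
    moreover have "y + s \<cdot>\<^sub>v x \<in> carrier_vec (dim_col M)" using M x y by auto
    ultimately show False using psd unfolding pos_semidef_def by fastforce
  qed
  then have "\<forall>i\<in>{0..<n}. y $ i * y $ i = 0"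
    using y by (subst (asm) scalar_prod_def, subst (asm) sum_nonneg_eq_0_iff) auto
  then show ?thesis using y unfolding y_def[symmetric] by (intro eq_vecI) auto
qed

text \<open>A dissipative pencil \<open>\<lambda>E - (J - R)\<close> is singular at \<open>\<lambda> = 1\<close> only on the common kernel of its
  coefficients.\<close>

lemma dissipative_kernel:
  fixes E J R :: "real mat"
  assumes E: "E \<in> carrier_mat n n" "E = E\<^sup>T" "pos_semidef E"
    and J: "J \<in> carrier_mat n n" "J = - J\<^sup>T"
    and R: "R \<in> carrier_mat n n" "R = R\<^sup>T" "pos_semidef R"
    and x: "x \<in> carrier_vec n" "E *\<^sub>v x = (J - R) *\<^sub>v x"
  shows "E *\<^sub>v x = 0\<^sub>v n" "J *\<^sub>v x = 0\<^sub>v n" "R *\<^sub>v x = 0\<^sub>v n"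
proof -
  have car: "E *\<^sub>v x \<in> carrier_vec n" "J *\<^sub>v x \<in> carrier_vec n" "R *\<^sub>v x \<in> carrier_vec n"
    using E(1) J(1) R(1) x(1) by auto
  have JR: "(J - R) *\<^sub>v x = J *\<^sub>v x - R *\<^sub>v x"
    by (rule minus_mult_distrib_mat_vec[OF J(1) R(1) x(1)])
  have "x \<bullet> (E *\<^sub>v x) = x \<bullet> (J *\<^sub>v x) - x \<bullet> (R *\<^sub>v x)"
    unfolding x(2) JR by (rule scalar_prod_minus_distrib[OF x(1) car(2,3)])
  moreover have "x \<bullet> (E *\<^sub>v x) \<ge> 0" "x \<bullet> (R *\<^sub>v x) \<ge> 0"
    using E R x(1) unfolding pos_semidef_def by auto
  ultimately have "x \<bullet> (E *\<^sub>v x) = 0" "x \<bullet> (R *\<^sub>v x) = 0"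
    using skew_quadratic_form_zero[OF J x(1)] by auto
  then show E0: "E *\<^sub>v x = 0\<^sub>v n" and R0: "R *\<^sub>v x = 0\<^sub>v n"
    using psd_quadratic_form_zero[OF E x(1)] psd_quadratic_form_zero[OF R x(1)] by auto
  then show "J *\<^sub>v x = 0\<^sub>v n" using x(2) JR car(2) by auto
qed

section \<open>The staircase form\<close>

text \<open>Blocks are counted from 0 here.\<close>

lemma has_blocks_index:
  assumes "has_blocks ns M B" "i < length ns" "j < length ns" "a < ns ! i" "b < ns ! j"
  shows "M $$ (sum_list (take i ns) + a, sum_list (take j ns) + b) = B ! i ! j $$ (a, b)"
proof -
  have "blk ns M (Suc i) (Suc j) = B ! i ! j"
    using assms(1-3) unfolding has_blocks_def
    by (metis Suc_le_eq Suc_pred' One_nat_def atLeastAtMost_iff diff_Suc_1 le_add1 plus_1_eq_Suc)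
  then have "blk ns M (Suc i) (Suc j) $$ (a, b) = B ! i ! j $$ (a, b)" by simp
  then show ?thesis using assms(4,5) unfolding blk_def by simp
qed

text \<open>If the rows of a nonsingular block annihilate \<open>x\<close> and the entries outside the block do not
  contribute, then the part of \<open>x\<close> that belongs to the columns of the block vanishes.\<close>

lemma block_kernel:
  fixes M :: "'a::field mat"
  assumes M: "M \<in> carrier_mat r c" and x: "x \<in> carrier_vec c" and "i0 + k \<le> r" "j0 + k \<le> c"
    and inv: "invertible_mat (mat k k (\<lambda>(a, b). M $$ (i0 + a, j0 + b)))"
    and zero: "\<And>a. a < k \<Longrightarrow> (M *\<^sub>v x) $ (i0 + a) = 0"
    and off: "\<And>a j. a < k \<Longrightarrow> j < c \<Longrightarrow> j \<notin> {j0..<j0 + k} \<Longrightarrow> M $$ (i0 + a, j) * x $ j = 0"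
    and j: "j0 \<le> j" "j < j0 + k"
  shows "x $ j = 0"
proof -
  let ?B = "mat k k (\<lambda>(a, b). M $$ (i0 + a, j0 + b))"
  let ?v = "vec k (\<lambda>b. x $ (j0 + b))"
  have B: "?B \<in> carrier_mat k k" by auto
  have "?B *\<^sub>v ?v = 0\<^sub>v k"
  proof (rule eq_vecI)
    fix a assume "a < dim_vec (0\<^sub>v k :: 'a vec)"
    then have a: "a < k" by simp
    have "(?B *\<^sub>v ?v) $ a = (\<Sum>b = 0..<k. M $$ (i0 + a, j0 + b) * x $ (j0 + b))"
      using a by (simp add: scalar_prod_def)
    also have "\<dots> = (\<Sum>j = j0..<j0 + k. M $$ (i0 + a, j) * x $ j)"
      using sum.shift_bounds_nat_ivl[of "\<lambda>j. M $$ (i0 + a, j) * x $ j" 0 j0 k] by (simp add: add.commute)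
    also have "\<dots> = (\<Sum>j = 0..<c. M $$ (i0 + a, j) * x $ j)"
      using assms(4) off[OF a] by (intro sum.mono_neutral_left) auto
    also have "\<dots> = 0"
      using zero[OF a] mult_mat_vec_index_sum[OF M x, of "i0 + a"] a assms(3) by simp
    finally show "(?B *\<^sub>v ?v) $ a = 0\<^sub>v k $ a" using a by simp
  qed simp
  moreover have "?v \<in> carrier_vec k" by simp
  ultimately have "?v = 0\<^sub>v k"
    using inv det_0_iff_vec_prod_zero_field[OF B] unfolding invertible_mat_iff_det[OF B] by blast
  then have "?v $ (j - j0) = 0" using j by simp
  moreover have "j - j0 < k" using j by simp
  ultimately have "x $ (j0 + (j - j0)) = 0" by (simp only: index_vec)
  then show ?thesis unfolding le_add_diff_inverse[OF j(1)] .
qed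

text \<open>A dissipative pencil in staircase form. The blocks 1 and 2 end before row \<open>p\<close>, block 3 ends
  before row \<open>q\<close> and block 4 before row \<open>m\<close>.\<close>

locale staircase =
  fixes n1 n2 n3 n4 n5 n :: nat and E J R :: "real mat"
  assumes n: "n = n1 + n2 + n3 + n4 + n5" and n4: "n4 = n1"
    and E: "E \<in> carrier_mat n n" "E = E\<^sup>T" "pos_semidef E"
    and J: "J \<in> carrier_mat n n" "J = - J\<^sup>T"
    and R: "R \<in> carrier_mat n n" "R = R\<^sup>T" "pos_semidef R"
    and form: "staircase_form n1 n2 n3 n4 n5 E J R"
begin

abbreviation A :: "real mat" where "A \<equiv> J - R"
abbreviation p :: nat where "p \<equiv> n1 + n2"
abbreviation q :: nat where "q \<equiv> n1 + n2 + n3"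
abbreviation m :: nat where "m \<equiv> n1 + n2 + n3 + n4"
abbreviation ns :: "nat list" where "ns \<equiv> [n1, n2, n3, n4, n5]"

lemma A: "A \<in> carrier_mat n n" using R(1) by auto

lemmas E_blocks = form[unfolded staircase_form_def Let_def, THEN conjunct1]
lemmas A_blocks = form[unfolded staircase_form_def Let_def, THEN conjunct2, THEN conjunct1]

lemma block_index:
  assumes "x < n"
  obtains i a where "x = sum_list (take i ns) + a" "i < 5" "a < ns ! i"
    "p \<le> x \<Longrightarrow> i \<in> {2, 3, 4}" "q \<le> x \<Longrightarrow> i \<in> {3, 4}" "m \<le> x \<Longrightarrow> i = 4" "n1 \<le> x \<Longrightarrow> i \<noteq> 0"
proof -
  consider "x < n1" | "n1 \<le> x" "x < p" | "p \<le> x" "x < q" | "q \<le> x" "x < m" | "m \<le> x" by linarith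
  then show thesis
  proof cases
    case 1
    then show thesis by (intro that[of 0 x]) auto
  next
    case 2
    then show thesis by (intro that[of 1 "x - n1"]) auto
  next
    case 3
    then show thesis by (intro that[of 2 "x - p"]) (auto simp: numeral_2_eq_2)
  next
    case 4
    then show thesis by (intro that[of 3 "x - q"]) (auto simp: numeral_3_eq_3)
  next
    case 5
    then show thesis using assms n by (intro that[of 4 "x - m"]) (auto simp: eval_nat_numeral)
  qed
qed

lemma E_zero:
  assumes "i < n" "j < n" "p \<le> i \<or> p \<le> j"
  shows "E $$ (i, j) = 0"
proof -
  have row: "E $$ (i, j) = 0" if ij: "i < n" "j < n" "p \<le> i" for i j
  proof -
    obtain k a where k: "i = sum_list (take k ns) + a" "k < 5" "a < ns ! k" "k \<in> {2, 3, 4}"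
      using block_index[OF ij(1)] ij(3) by metis
    obtain l b where l: "j = sum_list (take l ns) + b" "l < 5" "b < ns ! l"
      using block_index[OF ij(2)] by metis
    have "l \<in> {0, 1, 2, 3, 4}" using l(2) by auto
    show ?thesis
      using has_blocks_index[OF E_blocks, of k l a b] k(2-4) l(2,3) \<open>l \<in> {0, 1, 2, 3, 4}\<close>
      unfolding k(1) l(1) by (elim insertE emptyE) simp_all
  qed
  have "E $$ (i, j) = E $$ (j, i)" if "i < n" "j < n" for i j
    using that E(1) arg_cong[OF E(2), of "\<lambda>M. M $$ (i, j)"] by simp
  then show ?thesis using assms row by metis
qed

text \<open>Block row 4 vanishes outside block column 1, block column 4 vanishes outside block row 1, and
  block row and block column 5 vanish altogether.\<close>

lemma A_zero:
  assumes "i < n" "j < n" "q \<le> i \<and> n1 \<le> j \<or> n1 \<le> i \<and> q \<le> j \<or> m \<le> i \<or> m \<le> j"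
  shows "A $$ (i, j) = 0"
proof -
  obtain k a where k: "i = sum_list (take k ns) + a" "k < 5" "a < ns ! k"
    "q \<le> i \<Longrightarrow> k \<in> {3, 4}" "m \<le> i \<Longrightarrow> k = 4" "n1 \<le> i \<Longrightarrow> k \<noteq> 0"
    using block_index[OF assms(1)] by metis
  obtain l b where l: "j = sum_list (take l ns) + b" "l < 5" "b < ns ! l"
    "q \<le> j \<Longrightarrow> l \<in> {3, 4}" "m \<le> j \<Longrightarrow> l = 4" "n1 \<le> j \<Longrightarrow> l \<noteq> 0"
    using block_index[OF assms(2)] by metis
  have kl: "k \<in> {0, 1, 2, 3, 4}" "l \<in> {0, 1, 2, 3, 4}" using k(2) l(2) by auto
  have kl': "k \<in> {3, 4} \<and> l \<noteq> 0 \<or> k \<noteq> 0 \<and> l \<in> {3, 4} \<or> k = 4 \<or> l = 4"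
    using assms(3) k(4-6) l(4-6) by blast
  show ?thesis
    using has_blocks_index[OF A_blocks, of k l a b] k(3) l(3) kl kl'
    unfolding k(1) l(1) by (elim insertE emptyE) simp_all
qed

lemma nonsingular_blocks:
  shows A33: "invertible_mat (mat n3 n3 (\<lambda>(a, b). A $$ (p + a, p + b)))"
    and A41: "invertible_mat (mat n1 n1 (\<lambda>(a, b). A $$ (q + a, 0 + b)))"
    and A14: "invertible_mat (mat n1 n1 (\<lambda>(a, b). A $$ (0 + a, q + b)))"
proof -
  note f = form[unfolded staircase_form_def Let_def]
  note blk = bspec[OF bspec[OF conjunct2[OF A_blocks[unfolded has_blocks_def]]]]
  have "blk ns A 3 3 = blk ns J 3 3 - blk ns R 3 3"
    by (subst blk) auto
  moreover have "blk ns A 3 3 = mat n3 n3 (\<lambda>(a, b). A $$ (p + a, p + b))"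
    unfolding blk_def by (simp add: eval_nat_numeral)
  ultimately show "invertible_mat (mat n3 n3 (\<lambda>(a, b). A $$ (p + a, p + b)))" using f by simp
  have "blk ns A 4 1 = blk ns J 4 1"
    by (subst blk) auto
  moreover have 41: "blk ns A 4 1 = mat n1 n1 (\<lambda>(a, b). A $$ (q + a, 0 + b))"
    unfolding blk_def by (simp add: eval_nat_numeral n4 add.assoc)
  ultimately show A41: "invertible_mat (mat n1 n1 (\<lambda>(a, b). A $$ (q + a, 0 + b)))"
    using f by metis
  have "blk ns A 1 4 = blk ns J 1 4"
    by (subst blk) auto
  moreover have 14: "blk ns A 1 4 = mat n1 n1 (\<lambda>(a, b). A $$ (0 + a, q + b))" (is "_ = ?A14")
    unfolding blk_def by (simp add: eval_nat_numeral n4 add.assoc)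
  ultimately have eq: "mat n1 n1 (\<lambda>(a, b). A $$ (q + a, 0 + b)) = - ?A14\<^sup>T"
    using f \<open>blk ns A 4 1 = blk ns J 4 1\<close> 41 by metis
  have "- ?A14\<^sup>T = (- 1) \<cdot>\<^sub>m ?A14\<^sup>T" by (rule eq_matI) auto
  moreover have "?A14 \<in> carrier_mat n1 n1" by auto
  ultimately show "invertible_mat ?A14"
    using A41 unfolding eq
    by (simp add: invertible_mat_iff_det[of _ n1] det_transpose[of _ n1])
qed

lemma E_index_sum:
  assumes "x \<in> carrier_vec n" "i < p"
  shows "(E *\<^sub>v x) $ i = (\<Sum>j = 0..<p. E $$ (i, j) * x $ j)"
proof -
  have "(E *\<^sub>v x) $ i = (\<Sum>j = 0..<n. E $$ (i, j) * x $ j)"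
    using assms n by (intro mult_mat_vec_index_sum[OF E(1)]) auto
  also have "\<dots> = (\<Sum>j = 0..<p. E $$ (i, j) * x $ j)"
    using assms n E_zero by (intro sum.mono_neutral_right) auto
  finally show ?thesis .
qed

lemma E_index_zero:
  assumes "x \<in> carrier_vec n" "p \<le> i" "i < n"
  shows "(E *\<^sub>v x) $ i = 0"
  using mult_mat_vec_index_sum[OF E(1) assms(1,3)] E_zero assms by simp

lemma E_kernelI:
  assumes "x \<in> carrier_vec n" "\<And>i. i < p \<Longrightarrow> x $ i = 0"
  shows "E *\<^sub>v x = 0\<^sub>v n"
proof (rule eq_vecI)
  fix i assume "i < dim_vec (0\<^sub>v n :: real vec)"
  then show "(E *\<^sub>v x) $ i = 0\<^sub>v n $ i"
    using E_index_sum[OF assms(1), of i] E_index_zero[OF assms(1), of i] assms(2)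
    by (cases "i < p") auto
qed (use E in auto)

text \<open>The leading block of \<open>E\<close>.\<close>

abbreviation Ep :: "real mat" where "Ep \<equiv> mat p p (\<lambda>(i, j). E $$ (i, j))"

lemma Ep_pos_def: "pos_def Ep"
proof -
  have "four_block_mat (blk ns E 1 1) (blk ns E 1 2) (blk ns E 2 1) (blk ns E 2 2) = Ep"
    by (rule eq_matI) (auto simp: blk_def eval_nat_numeral)
  then show ?thesis using form unfolding staircase_form_def Let_def by metis
qed

lemma E_quadratic_form_zero:
  assumes x: "x \<in> carrier_vec n" and zero: "x \<bullet> (E *\<^sub>v x) = 0" and "i < p"
  shows "x $ i = 0"
proof (rule ccontr)
  assume "x $ i \<noteq> 0"
  let ?y = "vec p (\<lambda>i. x $ i)"
  have Ep_y: "(Ep *\<^sub>v ?y) $ k = (E *\<^sub>v x) $ k" if "k < p" for k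
    unfolding E_index_sum[OF x that] using that by (simp add: scalar_prod_def)
  have "x \<bullet> (E *\<^sub>v x) = (\<Sum>k = 0..<n. x $ k * (E *\<^sub>v x) $ k)"
    using E(1) by (simp add: scalar_prod_def)
  also have "\<dots> = (\<Sum>k = 0..<p. x $ k * (E *\<^sub>v x) $ k)"
    using E_index_zero[OF x] n by (intro sum.mono_neutral_right) auto
  also have "\<dots> = ?y \<bullet> (Ep *\<^sub>v ?y)"
    using Ep_y by (simp add: scalar_prod_def del: index_mult_mat_vec)
  finally have "?y \<bullet> (Ep *\<^sub>v ?y) = 0" using zero by simp
  moreover have "?y \<in> carrier_vec (dim_col Ep)" "?y \<noteq> 0\<^sub>v (dim_col Ep)"
    using \<open>x $ i \<noteq> 0\<close> \<open>i < p\<close> by (auto simp: vec_eq_iff)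
  ultimately show False using Ep_pos_def unfolding pos_def_def by fastforce
qed

lemma E_kernelD:
  assumes "x \<in> carrier_vec n" "E *\<^sub>v x = 0\<^sub>v n" "i < p"
  shows "x $ i = 0"
  using E_quadratic_form_zero[OF assms(1) _ assms(3)] assms(1,2) by simp

text \<open>The range of \<open>E\<close> consists of the vectors supported in the leading block.\<close>

lemma E_surj:
  assumes y: "y \<in> carrier_vec n" "\<And>i. p \<le> i \<Longrightarrow> i < n \<Longrightarrow> y $ i = 0"
  obtains x where "x \<in> carrier_vec n" "E *\<^sub>v x = y"
proof -
  have Ep: "Ep \<in> carrier_mat p p" by auto
  have "Determinant.det Ep \<noteq> 0"
  proof
    assume "Determinant.det Ep = 0"
    then obtain v where "v \<in> carrier_vec p" "v \<noteq> 0\<^sub>v p" "Ep *\<^sub>v v = 0\<^sub>v p"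
      using det_0_iff_vec_prod_zero_field[OF Ep] by blast
    then show False using Ep_pos_def unfolding pos_def_def by fastforce
  qed
  then have "invertible_mat Ep" using invertible_mat_iff_det[OF Ep] by simp
  then obtain F where F: "F \<in> carrier_mat p p" "Ep * F = 1\<^sub>m p"
    using invertible_mat_inverseE[OF Ep] by metis
  let ?y = "vec p (\<lambda>i. y $ i)"
  define v where "v = F *\<^sub>v ?y"
  have y': "?y \<in> carrier_vec p" by simp
  have v: "v \<in> carrier_vec p" unfolding v_def by (rule mult_mat_vec_carrier[OF F(1) y'])
  have Epv: "Ep *\<^sub>v v = ?y"
    unfolding v_def assoc_mult_mat_vec[OF Ep F(1) y', symmetric] F(2) by (rule one_mult_mat_vec[OF y'])
  let ?x = "vec n (\<lambda>i. if i < p then v $ i else 0)"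
  have x: "?x \<in> carrier_vec n" by simp
  have "E *\<^sub>v ?x = y"
  proof (rule eq_vecI)
    fix i assume "i < dim_vec y"
    then have i: "i < n" using y by simp
    show "(E *\<^sub>v ?x) $ i = y $ i"
    proof (cases "i < p")
      case True
      have "(E *\<^sub>v ?x) $ i = (\<Sum>j = 0..<p. E $$ (i, j) * v $ j)"
        unfolding E_index_sum[OF x True] using n by (intro sum.cong) auto
      also have "\<dots> = (Ep *\<^sub>v v) $ i" using True v by (simp add: scalar_prod_def)
      finally show ?thesis unfolding Epv using True by simp
    qed (use i y(2) E_index_zero[OF x] in simp)
  qed (use E y in auto)
  then show thesis using that x by blast
qed

text \<open>The next three lemmas use the nonsingular blocks \<open>J33 - R33\<close>, \<open>J41\<close> and \<open>J14\<close> in turn.\<close>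

lemma third_block_zero:
  assumes x: "x \<in> carrier_vec n" and lead: "\<And>i. i < p \<Longrightarrow> x $ i = 0"
    and Ax: "\<And>i. p \<le> i \<Longrightarrow> i < q \<Longrightarrow> (A *\<^sub>v x) $ i = 0" and "p \<le> i" "i < q"
  shows "x $ i = 0"
proof (rule block_kernel[OF A x _ _ A33])
  show "A $$ (p + a, j) * x $ j = 0" if "a < n3" "j < n" "j \<notin> {p..<p + n3}" for a j
    using that lead A_zero[of "p + a" j] n by (cases "j < p") auto
qed (use assms n in auto)

lemma first_block_zero:
  assumes x: "x \<in> carrier_vec n" and Ax: "\<And>i. q \<le> i \<Longrightarrow> i < m \<Longrightarrow> (A *\<^sub>v x) $ i = 0"
    and "i < n1"
  shows "x $ i = 0"
proof (rule block_kernel[OF A x _ _ A41])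
  show "A $$ (q + a, j) * x $ j = 0" if "a < n1" "j < n" "j \<notin> {0..<0 + n1}" for a j
    using that A_zero[of "q + a" j] n n4 by auto
qed (use assms n n4 in auto)

lemma fourth_block_zero:
  assumes x: "x \<in> carrier_vec n" and lead: "\<And>i. i < q \<Longrightarrow> x $ i = 0"
    and Ax: "\<And>i. i < n1 \<Longrightarrow> (A *\<^sub>v x) $ i = 0" and "q \<le> i" "i < m"
  shows "x $ i = 0"
proof (rule block_kernel[OF A x _ _ A14])
  show "A $$ (0 + a, j) * x $ j = 0" if "a < n1" "j < n" "j \<notin> {q..<q + n1}" for a j
    using that lead A_zero[of a j] n n4 by (cases "j < q") auto
qed (use assms n n4 in auto)

lemma A_kernelI:
  assumes x: "x \<in> carrier_vec n" and "\<And>i. i < m \<Longrightarrow> x $ i = 0"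
  shows "A *\<^sub>v x = 0\<^sub>v n"
proof (rule eq_vecI)
  fix i assume "i < dim_vec (0\<^sub>v n :: real vec)"
  then have i: "i < n" by simp
  have "A $$ (i, j) * x $ j = 0" if "j < n" for j
    using assms(2)[of j] A_zero[OF i that] by (cases "j < m") auto
  then have "(\<Sum>j = 0..<n. A $$ (i, j) * x $ j) = 0" by (intro sum.neutral) simp
  then show "(A *\<^sub>v x) $ i = 0\<^sub>v n $ i" unfolding mult_mat_vec_index_sum[OF A x i] using i by simp
qed (use A in auto)

lemma kernel_E_A:
  assumes x: "x \<in> carrier_vec n" and "E *\<^sub>v x = 0\<^sub>v n" "A *\<^sub>v x = 0\<^sub>v n" "i < m"
  shows "x $ i = 0"
proof -
  have Ax: "(A *\<^sub>v x) $ i = 0" if "i < m" for i using assms(3) that n by simp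
  note lead = E_kernelD[OF x assms(2)]
  have third: "x $ i = 0" if "p \<le> i" "i < q" for i
    by (rule third_block_zero[OF x lead _ that]) (use Ax in auto)
  have "x $ i = 0" if "q \<le> i" "i < m" for i
  proof (rule fourth_block_zero[OF x _ _ that])
    show "x $ i = 0" if "i < q" for i using lead third that by (cases "i < p") auto
  qed (use Ax in auto)
  then show ?thesis using lead third assms(4) by (meson not_le)
qed

section \<open>Dead chains of a pencil in staircase form\<close>

text \<open>For a chain \<open>x, y, z\<close> whose first vector is supported in the blocks 4 and 5: block row 4 of the second
  step makes the first block of \<open>y\<close> vanish, whereas \<open>A x\<close> is supported in the first block; hence
  \<open>y \<bullet> E y = y \<bullet> A x = 0\<close>, and \<open>y\<close> is in the kernel of \<open>E\<close>.\<close>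

lemma chain_end:
  assumes x: "x \<in> carrier_vec n" "\<And>i. i < q \<Longrightarrow> x $ i = 0"
    and y: "y \<in> carrier_vec n" "E *\<^sub>v y = A *\<^sub>v x" and z: "z \<in> carrier_vec n" "E *\<^sub>v z = A *\<^sub>v y"
  shows "A *\<^sub>v x = 0\<^sub>v n"
proof -
  have "y $ i = 0" if "i < n1" for i
  proof (rule first_block_zero[OF y(1) _ that])
    show "(A *\<^sub>v y) $ i = 0" if "q \<le> i" "i < m" for i
      using E_index_zero[OF z(1), of i] that n unfolding z(2) by auto
  qed
  moreover have "(A *\<^sub>v x) $ i = 0" if "n1 \<le> i" "i < n" for i
  proof -
    have "A $$ (i, j) * x $ j = 0" if "j < n" for j
      using x(2)[of j] A_zero[of i j] that \<open>n1 \<le> i\<close> \<open>i < n\<close> by (cases "j < q") auto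
    then show ?thesis
      unfolding mult_mat_vec_index_sum[OF A x(1) that(2)] by (intro sum.neutral) simp
  qed
  ultimately have "y $ i * (A *\<^sub>v x) $ i = 0" if "i < n" for i
    using that by (cases "i < n1") auto
  then have "y \<bullet> (E *\<^sub>v y) = 0"
    unfolding y(2) scalar_prod_def using R(1) by (intro sum.neutral) simp
  then have "E *\<^sub>v y = 0\<^sub>v n"
    using E_kernelI[OF y(1)] E_quadratic_form_zero[OF y(1)] by blast
  then show ?thesis using y(2) by simp
qed

text \<open>A chain of one step that begins in the kernel of \<open>E\<close> begins in the blocks 4 and 5, because
  block row 3 of \<open>E\<close> is zero.\<close>

lemma chain_start:
  assumes x: "x \<in> carrier_vec n" "E *\<^sub>v x = 0\<^sub>v n" and y: "y \<in> carrier_vec n" "E *\<^sub>v y = A *\<^sub>v x"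
    and "i < q"
  shows "x $ i = 0"
proof (cases "i < p")
  case True
  then show ?thesis using E_kernelD[OF x] by blast
next
  case False
  show ?thesis
  proof (rule third_block_zero[OF x(1) E_kernelD[OF x]])
    show "(A *\<^sub>v x) $ i = 0" if "p \<le> i" "i < q" for i
      using E_index_zero[OF y(1), of i] that n unfolding y(2) by auto
  qed (use False assms(5) in auto)
qed

lemma dead_chain_2: "\<not> dead_chain E A 2"
proof
  assume "dead_chain E A 2"
  then obtain x where x: "\<And>i. x i \<in> carrier_vec n" "E *\<^sub>v x 0 = 0\<^sub>v n"
    "\<And>i. i < 2 \<Longrightarrow> E *\<^sub>v x (Suc i) = A *\<^sub>v x i" "\<not> prolongable E A (x 0)"
    using E(1) by (rule dead_chainE) blast
  have 1: "E *\<^sub>v x 1 = A *\<^sub>v x 0" "E *\<^sub>v x 2 = A *\<^sub>v x 1"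
    using x(3)[of 0] x(3)[of 1] by (simp_all add: numeral_2_eq_2)
  have "A *\<^sub>v x 0 = 0\<^sub>v n"
    by (rule chain_end[OF x(1) _ x(1) 1(1) x(1) 1(2)]) (rule chain_start[OF x(1,2,1) 1(1)])
  then show False using prolongable_kernel[OF E(1) A x(1)] x(4) by blast
qed

lemma dead_chain_1: "dead_chain E A 1 \<longleftrightarrow> n1 > 0"
proof
  assume "dead_chain E A 1"
  then obtain x where x: "\<And>i. x i \<in> carrier_vec n" "E *\<^sub>v x 0 = 0\<^sub>v n"
    "\<And>i. i < 1 \<Longrightarrow> E *\<^sub>v x (Suc i) = A *\<^sub>v x i" "\<not> prolongable E A (x 0)"
    using E(1) by (rule dead_chainE) blast
  have 1: "E *\<^sub>v x 1 = A *\<^sub>v x 0" using x(3)[of 0] by simp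
  show "n1 > 0"
  proof (rule ccontr)
    assume "\<not> n1 > 0"
    then have "A *\<^sub>v x 0 = 0\<^sub>v n"
      using chain_start[OF x(1,2,1) 1] n4 by (intro A_kernelI[OF x(1)]) auto
    then show False using prolongable_kernel[OF E(1) A x(1)] x(4) by blast
  qed
next
  assume n1: "n1 > 0"
  \<comment> \<open>the first unit vector of block 4; \<open>A\<close> maps it into the range of \<open>E\<close>\<close>
  let ?e = "unit_vec n q :: real vec"
  have q: "q < n" "q < m" using n1 n n4 by auto
  have e: "?e \<in> carrier_vec n" "\<And>i. i < q \<Longrightarrow> ?e $ i = 0" using q by auto
  have "(A *\<^sub>v ?e) $ i = 0" if "p \<le> i" "i < n" for i
  proof -
    have "A $$ (i, j) * ?e $ j = 0" if "j < n" for j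
      using A_zero[of i q] \<open>p \<le> i\<close> \<open>i < n\<close> q that by (cases "j = q") auto
    then show ?thesis
      unfolding mult_mat_vec_index_sum[OF A e(1) that(2)] by (intro sum.neutral) simp
  qed
  then obtain y where y: "y \<in> carrier_vec n" "E *\<^sub>v y = A *\<^sub>v ?e"
    using E_surj[of "A *\<^sub>v ?e"] A by (metis mult_mat_vec_carrier e(1))
  let ?x = "\<lambda>i. if i = 0 then ?e else y"
  show "dead_chain E A 1"
  proof (rule dead_chainI[of ?x, OF _ _ _ _ E(1)])
    show "\<not> prolongable E A (?x 0)"
    proof
      assume "prolongable E A (?x 0)"
      then have "prolongable E A ?e" by simp
      then obtain z where z: "z 0 = ?e" "\<And>i. z i \<in> carrier_vec n"
        "\<And>i. E *\<^sub>v z (Suc i) = A *\<^sub>v z i" using E(1) by (rule prolongableE) blast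
      have "A *\<^sub>v ?e = 0\<^sub>v n"
        using chain_end[OF e z(2) _ z(2) z(3)[of 1]] z(3)[of 0] z(1) by simp
      then have "?e $ q = 0"
        using q n by (intro fourth_block_zero[OF e]) auto
      then show False using q by simp
    qed
    show "E *\<^sub>v ?x 0 = 0\<^sub>v n" using E_kernelI[OF e(1)] e(2) by simp
  qed (use e y in auto)
qed

lemma dead_chain_mono:
  assumes "dead_chain F B k" "l \<le> k"
  shows "dead_chain F B l"
  using assms unfolding dead_chain_def by (meson less_le_trans)

lemma dead_chain_0: "dead_chain E A 0 \<longleftrightarrow> n1 > 0 \<or> n3 > 0"
proof
  assume "dead_chain E A 0"
  then obtain x where x: "\<And>i. x i \<in> carrier_vec n" "E *\<^sub>v x 0 = 0\<^sub>v n"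
    "\<And>i. i < 0 \<Longrightarrow> E *\<^sub>v x (Suc i) = A *\<^sub>v x i" "\<not> prolongable E A (x 0)"
    using E(1) by (rule dead_chainE) blast
  show "n1 > 0 \<or> n3 > 0"
  proof (rule ccontr)
    assume "\<not> (n1 > 0 \<or> n3 > 0)"
    then have "A *\<^sub>v x 0 = 0\<^sub>v n"
      using E_kernelD[OF x(1,2)] n4 by (intro A_kernelI[OF x(1)]) auto
    then show False using prolongable_kernel[OF E(1) A x(1)] x(4) by blast
  qed
next
  assume "n1 > 0 \<or> n3 > 0"
  then show "dead_chain E A 0"
  proof
    assume "n1 > 0"
    then show ?thesis using dead_chain_1 dead_chain_mono[of E A 1 0] by simp
  next
    assume n3: "n3 > 0"
    \<comment> \<open>the first unit vector of block 3\<close>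
    let ?e = "unit_vec n p :: real vec"
    have p: "p < n" "p < q" using n3 n by auto
    have e: "?e \<in> carrier_vec n" "\<And>i. i < p \<Longrightarrow> ?e $ i = 0" using p by auto
    have ker: "E *\<^sub>v ?e = 0\<^sub>v n" using E_kernelI[OF e] .
    show ?thesis
    proof (rule dead_chainI[of "\<lambda>_. ?e", OF _ _ _ _ E(1)])
      show "\<not> prolongable E A ?e"
      proof
        assume "prolongable E A ?e"
        then obtain z where z: "z 0 = ?e" "\<And>i. z i \<in> carrier_vec n"
          "\<And>i. E *\<^sub>v z (Suc i) = A *\<^sub>v z i" using E(1) by (rule prolongableE) blast
        have "?e $ p = 0"
          using chain_start[OF e(1) ker z(2) _ p(2)] z(3)[of 0] z(1) by simp
        then show False using p by simp
      qed
    qed (use e ker in auto)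
  qed
qed

section \<open>Regularity and index of a pencil in staircase form\<close>

lemma invertible_E_minus_A:
  assumes "n5 = 0"
  shows "invertible_mat (1 \<cdot>\<^sub>m E - A)"
proof -
  have C: "1 \<cdot>\<^sub>m E - A \<in> carrier_mat n n" by (rule minus_carrier_mat[OF A])
  have "v = 0\<^sub>v n" if v: "v \<in> carrier_vec n" "(1 \<cdot>\<^sub>m E - A) *\<^sub>v v = 0\<^sub>v n" for v
  proof -
    have car: "E *\<^sub>v v \<in> carrier_vec n" "A *\<^sub>v v \<in> carrier_vec n" using E(1) A v(1) by auto
    have "1 \<cdot>\<^sub>m E = E" by (rule eq_matI) auto
    then have "E *\<^sub>v v - A *\<^sub>v v = 0\<^sub>v n"
      using v(2) minus_mult_distrib_mat_vec[OF E(1) A v(1)] by simp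
    then have "E *\<^sub>v v = A *\<^sub>v v" using minus_vec_eq_zeroD[OF car] by blast
    note ker = dissipative_kernel[OF E J R v(1) this]
    have "A *\<^sub>v v = 0\<^sub>v n" using ker(1) \<open>E *\<^sub>v v = A *\<^sub>v v\<close> by simp
    then show ?thesis using kernel_E_A[OF v(1) ker(1)] assms n v(1) by (intro eq_vecI) auto
  qed
  then show ?thesis
    unfolding invertible_mat_iff_det[OF C] using det_0_iff_vec_prod_zero_field[OF C] by blast
qed

lemma regular_pencil_iff:
  "\<not> regular_pencil (complex_mat E) (complex_mat A) \<longleftrightarrow>
     (\<exists>v \<in> mat_kernel E \<inter> mat_kernel J \<inter> mat_kernel R. v \<noteq> 0\<^sub>v n)"
proof
  assume "\<not> regular_pencil (complex_mat E) (complex_mat A)"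
  then have "Determinant.det (1 \<cdot>\<^sub>m complex_mat E - complex_mat A) = 0"
    unfolding regular_pencil_def by blast
  also have "1 \<cdot>\<^sub>m complex_mat E - complex_mat A = complex_mat (E - A)"
    using E(1) J(1) R(1) by (intro eq_matI) auto
  finally have "Determinant.det (E - A) = 0" by simp
  moreover have "E - A \<in> carrier_mat n n" by (rule minus_carrier_mat[OF A])
  ultimately obtain v where v: "v \<in> carrier_vec n" "v \<noteq> 0\<^sub>v n" "(E - A) *\<^sub>v v = 0\<^sub>v n"
    using det_0_iff_vec_prod_zero_field by blast
  have car: "E *\<^sub>v v \<in> carrier_vec n" "A *\<^sub>v v \<in> carrier_vec n" using E(1) A v(1) by auto
  have "E *\<^sub>v v - A *\<^sub>v v = 0\<^sub>v n"
    using v(3) minus_mult_distrib_mat_vec[OF E(1) A v(1)] by simp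
  then have "E *\<^sub>v v = A *\<^sub>v v" using minus_vec_eq_zeroD[OF car] by blast
  note ker = dissipative_kernel[OF E J R v(1) this]
  then have "v \<in> mat_kernel E \<inter> mat_kernel J \<inter> mat_kernel R"
    using v(1) E(1) J(1) R(1) by (auto simp: mat_kernel_def)
  then show "\<exists>v \<in> mat_kernel E \<inter> mat_kernel J \<inter> mat_kernel R. v \<noteq> 0\<^sub>v n" using v(2) by blast
next
  assume "\<exists>v \<in> mat_kernel E \<inter> mat_kernel J \<inter> mat_kernel R. v \<noteq> 0\<^sub>v n"
  then obtain v where v: "v \<in> carrier_vec n" "v \<noteq> 0\<^sub>v n"
    and ker: "E *\<^sub>v v = 0\<^sub>v n" "J *\<^sub>v v = 0\<^sub>v n" "R *\<^sub>v v = 0\<^sub>v n"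
    using E(1) J(1) R(1) by (auto simp: mat_kernel_def)
  have Av: "A *\<^sub>v v = 0\<^sub>v n"
    using minus_mult_distrib_mat_vec[OF J(1) R(1) v(1)] ker by simp
  let ?v = "map_vec complex_of_real v"
  have cv: "?v \<in> carrier_vec n" "?v \<noteq> 0\<^sub>v n" using v by (auto simp: vec_eq_iff)
  have cker: "complex_mat E *\<^sub>v ?v = 0\<^sub>v n" "complex_mat A *\<^sub>v ?v = 0\<^sub>v n"
  proof -
    have "map_vec complex_of_real (0\<^sub>v n) = 0\<^sub>v n" by auto
    then show "complex_mat E *\<^sub>v ?v = 0\<^sub>v n" "complex_mat A *\<^sub>v ?v = 0\<^sub>v n"
      unfolding of_real_hom.mult_mat_vec_hom[OF E(1) v(1), symmetric]
        of_real_hom.mult_mat_vec_hom[OF A v(1), symmetric] ker(1) Av by simp_all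
  qed
  have cE: "complex_mat E \<in> carrier_mat n n" and cA: "complex_mat A \<in> carrier_mat n n"
    using E(1) A by auto
  have "Determinant.det (l \<cdot>\<^sub>m complex_mat E - complex_mat A) = 0" for l
  proof -
    have "(l \<cdot>\<^sub>m complex_mat E) *\<^sub>v ?v = l \<cdot>\<^sub>v (complex_mat E *\<^sub>v ?v)"
      using cE cv(1) by (intro eq_vecI) (auto simp: scalar_prod_def sum_distrib_left mult.assoc)
    then have "(l \<cdot>\<^sub>m complex_mat E - complex_mat A) *\<^sub>v ?v = 0\<^sub>v n"
      using minus_mult_distrib_mat_vec[of "l \<cdot>\<^sub>m complex_mat E" n n "complex_mat A" ?v] cE cA cv(1) cker
      by auto
    moreover have "l \<cdot>\<^sub>m complex_mat E - complex_mat A \<in> carrier_mat n n" by (rule minus_carrier_mat[OF cA])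
    ultimately show ?thesis using det_0_iff_vec_prod_zero_field cv by blast
  qed
  then show "\<not> regular_pencil (complex_mat E) (complex_mat A)" unfolding regular_pencil_def by blast
qed

text \<open>The pencil is the direct sum of its regular leading part and a zero pencil of size \<open>n5\<close>.\<close>

lemma has_kcf_staircase: "has_kcf (complex_mat E) (complex_mat A)"
proof -
  let ?E0 = "mat m m (\<lambda>(i, j). E $$ (i, j))" and ?A0 = "mat m m (\<lambda>(i, j). A $$ (i, j))"
  have E0: "?E0 \<in> carrier_mat m m" and A0: "?A0 \<in> carrier_mat m m" by auto
  have n_m: "n = m + n5" using n by simp
  have E_eq: "E = four_block_mat ?E0 (0\<^sub>m m n5) (0\<^sub>m n5 m) (0\<^sub>m n5 n5)"
    using E_zero E(1) n_m by (intro eq_matI) auto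
  have A_eq: "A = four_block_mat ?A0 (0\<^sub>m m n5) (0\<^sub>m n5 m) (0\<^sub>m n5 n5)"
    using A_zero A n_m by (intro eq_matI) (auto simp del: index_minus_mat)
  have C: "?E0 - ?A0 \<in> carrier_mat m m" by auto
  have "v = 0\<^sub>v m" if v: "v \<in> carrier_vec m" "(?E0 - ?A0) *\<^sub>v v = 0\<^sub>v m" for v
  proof -
    let ?w = "v @\<^sub>v 0\<^sub>v n5"
    have w: "?w \<in> carrier_vec n" unfolding n_m using v(1) by (rule append_carrier_vec) simp
    have z: "(0\<^sub>v n5 :: real vec) \<in> carrier_vec n5" by simp
    have car: "?E0 *\<^sub>v v \<in> carrier_vec m" "?A0 *\<^sub>v v \<in> carrier_vec m"
      using mult_mat_vec_carrier[OF E0 v(1)] mult_mat_vec_carrier[OF A0 v(1)] by blast+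
    have "?E0 *\<^sub>v v - ?A0 *\<^sub>v v = 0\<^sub>v m"
      using v(2) minus_mult_distrib_mat_vec[OF E0 A0 v(1)] by simp
    then have "?E0 *\<^sub>v v = ?A0 *\<^sub>v v" using minus_vec_eq_zeroD[OF car] by blast
    moreover have "E *\<^sub>v ?w = (?E0 *\<^sub>v v) @\<^sub>v (0\<^sub>m n5 n5 *\<^sub>v 0\<^sub>v n5)"
      using block_diag_mult_vec[OF E0 zero_carrier_mat[of n5 n5] v(1) z] unfolding E_eq[symmetric] .
    moreover have "A *\<^sub>v ?w = (?A0 *\<^sub>v v) @\<^sub>v (0\<^sub>m n5 n5 *\<^sub>v 0\<^sub>v n5)"
      using block_diag_mult_vec[OF A0 zero_carrier_mat[of n5 n5] v(1) z] unfolding A_eq[symmetric] .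
    ultimately have EA: "E *\<^sub>v ?w = A *\<^sub>v ?w" by simp
    note ker = dissipative_kernel[OF E J R w EA]
    show ?thesis
    proof (rule eq_vecI)
      fix i assume "i < dim_vec (0\<^sub>v m :: real vec)"
      then show "v $ i = 0\<^sub>v m $ i"
        using kernel_E_A[OF w ker(1), of i] EA ker(1) v(1) by simp
    qed (use v in auto)
  qed
  then have det: "Determinant.det (?E0 - ?A0) \<noteq> 0" using det_0_iff_vec_prod_zero_field[OF C] by blast
  have "1 \<cdot>\<^sub>m complex_mat ?E0 - complex_mat ?A0 = complex_mat (?E0 - ?A0)"
    by (intro eq_matI) auto
  then have "Determinant.det (1 \<cdot>\<^sub>m complex_mat ?E0 - complex_mat ?A0) \<noteq> 0"
    using det by (simp only: of_real_hom.hom_det of_real_eq_0_iff not_False_eq_True)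
  then have "regular_pencil (complex_mat ?E0) (complex_mat ?A0)"
    unfolding regular_pencil_def by blast
  then have "has_kcf (complex_mat ?E0) (complex_mat ?A0)"
    by (intro has_kcf_regular_pencil[of _ m]) auto
  moreover have "complex_mat E =
      four_block_mat (complex_mat ?E0) (0\<^sub>m m n5) (0\<^sub>m n5 m) (0\<^sub>m n5 n5)"
    by (subst E_eq, rule eq_matI) auto
  moreover have "complex_mat A =
      four_block_mat (complex_mat ?A0) (0\<^sub>m m n5) (0\<^sub>m n5 m) (0\<^sub>m n5 n5)"
    by (subst A_eq, rule eq_matI) (auto simp del: index_minus_mat)
  ultimately show ?thesis
    using has_kcf_block_diag[OF _ has_kcf_zero, of "complex_mat ?E0" "complex_mat ?A0" m m n5 n5] by auto
qed

lemma less_index_iff: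
  "k < kronecker_index (complex_mat E) (complex_mat A) \<longleftrightarrow> dead_chain E A k"
  using less_kronecker_index_iff[OF has_kcf_staircase, of n n k] dead_chain_complex_mat[OF E(1) A]
    E(1) A by auto

lemma kronecker_index_staircase:
  "kronecker_index (complex_mat E) (complex_mat A) = (if n1 > 0 then 2 else if n3 > 0 then 1 else 0)"
  using less_index_iff[of 0] less_index_iff[of 1] less_index_iff[of 2]
    dead_chain_0 dead_chain_1 dead_chain_2 by auto

end

section \<open>The initial value problem\<close>

lemma mult_mat_vec_cong:
  fixes M :: "'a::semiring_0 mat"
  assumes M: "M \<in> carrier_mat r c" and x: "x \<in> carrier_vec c" and y: "y \<in> carrier_vec c"
    and agree: "\<And>i j. i < r \<Longrightarrow> j < c \<Longrightarrow> M $$ (i, j) = 0 \<or> x $ j = y $ j"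
  shows "M *\<^sub>v x = M *\<^sub>v y"
proof (rule eq_vecI)
  fix i assume "i < dim_vec (M *\<^sub>v y)"
  then have i: "i < r" using M by simp
  have "M $$ (i, j) * x $ j = M $$ (i, j) * y $ j" if "j < c" for j
    using agree[OF i that] by auto
  then show "(M *\<^sub>v x) $ i = (M *\<^sub>v y) $ i"
    unfolding mult_mat_vec_index_sum[OF M x i] mult_mat_vec_index_sum[OF M y i]
    by (intro sum.cong) auto
qed (use M in auto)

context staircase
begin

text \<open>The last \<open>n5\<close> components of a solution can be replaced by any continuously differentiable
  function.\<close>

lemma replace_last_component:
  assumes z: "solves_ivp E A I t0 z0 z" and w: "C1_fun I n5 w"
  shows "solves_ivp E A I t0 (vec_first z0 m @\<^sub>v w t0) (\<lambda>t. vec_first (z t) m @\<^sub>v w t)"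
proof -
  have n_m: "n = m + n5" using n by simp
  obtain z' where z': "C1_with_deriv I n z z'" "\<And>t. t \<in> I \<Longrightarrow> E *\<^sub>v z' t = A *\<^sub>v z t" "z t0 = z0"
    using z E(1) unfolding solves_ivp_def by auto
  obtain w' where w': "C1_with_deriv I n5 w w'" using w unfolding C1_fun_def by blast
  have car: "z t \<in> carrier_vec n" "z' t \<in> carrier_vec n" "w t \<in> carrier_vec n5" "w' t \<in> carrier_vec n5"
    if "t \<in> I" for t using z'(1) w' that unfolding C1_with_deriv_def by auto
  define y y' where "y t = vec_first (z t) m @\<^sub>v w t" and "y' t = vec_first (z' t) m @\<^sub>v w' t" for t
  have ycar: "y t \<in> carrier_vec n" "y' t \<in> carrier_vec n" if "t \<in> I" for t
    unfolding y_def y'_def n_m using car[OF that] by (auto intro!: append_carrier_vec)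
  have y_idx: "y t $ i = (if i < m then z t $ i else w t $ (i - m))"
      "y' t $ i = (if i < m then z' t $ i else w' t $ (i - m))" if "t \<in> I" "i < n" for t i
    using car[OF that(1)] that(2) n_m unfolding y_def y'_def by (auto simp: vec_first_def)
  have "((\<lambda>s. y s $ i) has_real_derivative y' t $ i) (at t within I) \<and>
      continuous_on I (\<lambda>t. y' t $ i)" if "t \<in> I" "i < n" for t i
  proof (cases "i < m")
    case True
    have d: "((\<lambda>s. z s $ i) has_vector_derivative z' t $ i) (at t within I)"
      using z'(1) that unfolding C1_with_deriv_def has_real_derivative_iff_has_vector_derivative by blast
    have c: "continuous_on I (\<lambda>t. z' t $ i)"
      using z'(1) that unfolding C1_with_deriv_def by blast
    have "y s $ i = z s $ i" "z' s $ i = y' s $ i" if "s \<in> I" for s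
      using y_idx[OF that \<open>i < n\<close>] True by auto
    then show ?thesis
      unfolding has_real_derivative_iff_has_vector_derivative
      using has_vector_derivative_transform[OF that(1) _ d] continuous_on_eq[OF c] that(1) by auto
  next
    case False
    have i: "i - m < n5" using that(2) False n_m by simp
    have d: "((\<lambda>s. w s $ (i - m)) has_vector_derivative w' t $ (i - m)) (at t within I)"
      using w' that(1) i unfolding C1_with_deriv_def has_real_derivative_iff_has_vector_derivative by blast
    have c: "continuous_on I (\<lambda>t. w' t $ (i - m))"
      using w' i unfolding C1_with_deriv_def by blast
    have "y s $ i = w s $ (i - m)" "w' s $ (i - m) = y' s $ i" if "s \<in> I" for s
      using y_idx[OF that \<open>i < n\<close>] False by auto
    then show ?thesis
      unfolding has_real_derivative_iff_has_vector_derivative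
      using has_vector_derivative_transform[OF that(1) _ d] continuous_on_eq[OF c] that(1) by auto
  qed
  moreover have "continuous_on {} (\<lambda>t. y' t $ i)" for i by simp
  ultimately have "C1_with_deriv I n y y'"
    unfolding C1_with_deriv_def using ycar by (cases "I = {}") auto
  moreover have "E *\<^sub>v y' t = A *\<^sub>v y t" if "t \<in> I" for t
  proof -
    have "E *\<^sub>v y' t = E *\<^sub>v z' t"
      by (rule mult_mat_vec_cong[OF E(1) ycar(2) car(2)]) (use that y_idx E_zero in auto)
    moreover have "A *\<^sub>v y t = A *\<^sub>v z t"
      by (rule mult_mat_vec_cong[OF A ycar(1) car(1)])
         (use that y_idx A_zero in \<open>auto simp del: index_minus_mat\<close>)
    ultimately show ?thesis using z'(2)[OF that] by simp
  qed
  ultimately show ?thesis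
    using E(1) unfolding solves_ivp_def y_def[symmetric] z'(3)[symmetric] by auto
qed

lemma not_uniquely_solvable:
  assumes "n5 \<noteq> 0" and I: "nondegenerate_interval I" "t0 \<in> I"
  shows "\<not> uniquely_solvable E A I t0 z0"
proof
  have n_m: "n = m + n5" using n by simp
  assume "uniquely_solvable E A I t0 z0"
  then obtain z where z: "solves_ivp E A I t0 z0 z"
    and uniq: "\<And>w t. solves_ivp E A I t0 z0 w \<Longrightarrow> t \<in> I \<Longrightarrow> w t = z t"
    unfolding uniquely_solvable_def by blast
  obtain z' where z': "C1_with_deriv I n z z'" "z t0 = z0"
    using z E(1) unfolding solves_ivp_def by auto
  \<comment> \<open>the last component of \<open>z\<close>, perturbed by a function that vanishes only at \<open>t0\<close>\<close>
  define w w' where "w t = vec n5 (\<lambda>i. z t $ (m + i) + (t - t0))"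
    and "w' t = vec n5 (\<lambda>i. z' t $ (m + i) + 1)" for t
  have "((\<lambda>s. w s $ i) has_real_derivative w' t $ i) (at t within I)"
    if "i < n5" "t \<in> I" for i t
  proof -
    have "((\<lambda>s. z s $ (m + i)) has_real_derivative z' t $ (m + i)) (at t within I)"
      using z'(1) that n_m unfolding C1_with_deriv_def by simp
    moreover have "((\<lambda>s. s - t0) has_real_derivative 1) (at t within I)"
      using DERIV_diff[OF DERIV_ident DERIV_const] by simp
    ultimately have "((\<lambda>s. z s $ (m + i) + (s - t0)) has_real_derivative z' t $ (m + i) + 1) (at t within I)"
      by (rule DERIV_add)
    then show ?thesis using that(1) by (simp add: w_def w'_def)
  qed
  moreover have "continuous_on I (\<lambda>t. w' t $ i)" if "i < n5" for i
  proof -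
    have "continuous_on I (\<lambda>t. z' t $ (m + i) + 1)"
      using z'(1) that n_m unfolding C1_with_deriv_def by (intro continuous_on_add continuous_on_const) simp
    then show ?thesis using that by (simp add: w'_def)
  qed
  ultimately have "C1_with_deriv I n5 w w'"
    unfolding C1_with_deriv_def by (auto simp: w_def w'_def)
  then have "C1_fun I n5 w" unfolding C1_fun_def by blast
  then have *: "solves_ivp E A I t0 (vec_first z0 m @\<^sub>v w t0) (\<lambda>t. vec_first (z t) m @\<^sub>v w t)"
    by (rule replace_last_component[OF z])
  have "z0 \<in> carrier_vec n" using z' I(2) unfolding C1_with_deriv_def by auto
  then have z0_eq: "vec_first z0 m @\<^sub>v w t0 = z0"
    unfolding w_def z'(2) using n_m by (intro eq_vecI) (auto simp: vec_first_def)
  obtain s where s: "s \<in> I" "s \<noteq> t0" by (rule nondegenerate_interval_other_point[OF I(1)])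
  have "vec_first (z s) m @\<^sub>v w s = z s" by (rule uniq[OF *[unfolded z0_eq] s(1)])
  then have "(vec_first (z s) m @\<^sub>v w s) $ m = z s $ m" by (rule arg_cong)
  then show False using assms(1) s(2) by (simp add: w_def vec_first_def)
qed

lemma uniquely_solvable:
  assumes "n5 = 0" and I: "nondegenerate_interval I" "t0 \<in> I" and "consistent_value E A I t0 z0"
  shows "uniquely_solvable E A I t0 z0"
  using assms(4) regular_ivp_unique[OF E(1) A invertible_E_minus_A[OF assms(1)] I]
  unfolding consistent_value_def uniquely_solvable_def by metis

end

theorem corollary7p5:
  fixes E J R :: "real mat" and n n1 n2 n3 n4 n5 :: nat
    and I :: "real set" and t0 :: real and z0 :: "real vec"
  assumes dims: "n = n1 + n2 + n3 + n4 + n5" "n4 = n1"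
    and carriers: "E \<in> carrier_mat n n" "J \<in> carrier_mat n n" "R \<in> carrier_mat n n"
      "z0 \<in> carrier_vec n"
    and J_skew: "J = - transpose_mat J"
    and R_psd: "R = transpose_mat R" "pos_semidef R"
    and E_psd: "E = transpose_mat E" "pos_semidef E"
    and staircase: "staircase_form n1 n2 n3 n4 n5 E J R"
    and interval: "nondegenerate_interval I" "t0 \<in> I"
  shows
    "(consistent_value E (J - R) I t0 z0 \<longrightarrow>
        (uniquely_solvable E (J - R) I t0 z0 \<longleftrightarrow> n5 = 0))
     \<and> (n5 \<noteq> 0 \<longrightarrow>
        (\<forall>z w. solves_ivp E (J - R) I t0 z0 z \<and> C1_fun I n5 w \<longrightarrow>
           solves_ivp E (J - R) I t0 (vec_first z0 (n1 + n2 + n3 + n4) @\<^sub>v w t0)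
             (\<lambda>t. vec_first (z t) (n1 + n2 + n3 + n4) @\<^sub>v w t)))
     \<and> (\<not> regular_pencil (complex_mat E) (complex_mat (J - R)) \<longleftrightarrow>
        (\<exists>v \<in> mat_kernel E \<inter> mat_kernel J \<inter> mat_kernel R. v \<noteq> 0\<^sub>v n))
     \<and> (kronecker_index (complex_mat E) (complex_mat (J - R)) = 0 \<longleftrightarrow>
        n1 = 0 \<and> n4 = 0 \<and> n3 = 0)
     \<and> (kronecker_index (complex_mat E) (complex_mat (J - R)) = 1 \<longleftrightarrow>
        n1 = 0 \<and> n4 = 0 \<and> n3 > 0)
     \<and> (kronecker_index (complex_mat E) (complex_mat (J - R)) = 2 \<longleftrightarrow>
        n1 = n4 \<and> n4 > 0)"
proof -
  interpret staircase n1 n2 n3 n4 n5 n E J R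
    using dims carriers J_skew R_psd E_psd staircase by unfold_locales
  show ?thesis
  proof (intro conjI impI allI)
    assume "consistent_value E (J - R) I t0 z0"
    then show "uniquely_solvable E (J - R) I t0 z0 \<longleftrightarrow> n5 = 0"
      using uniquely_solvable[OF _ interval] not_uniquely_solvable[OF _ interval] by blast
  next
    fix z w assume "solves_ivp E (J - R) I t0 z0 z \<and> C1_fun I n5 w"
    then show "solves_ivp E (J - R) I t0 (vec_first z0 (n1 + n2 + n3 + n4) @\<^sub>v w t0)
        (\<lambda>t. vec_first (z t) (n1 + n2 + n3 + n4) @\<^sub>v w t)"
      using replace_last_component by blast
  next
    show "\<not> regular_pencil (complex_mat E) (complex_mat (J - R)) \<longleftrightarrow>
        (\<exists>v \<in> mat_kernel E \<inter> mat_kernel J \<inter> mat_kernel R. v \<noteq> 0\<^sub>v n)"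
      by (rule regular_pencil_iff)
  qed (use dims(2) in \<open>auto simp: kronecker_index_staircase\<close>)
qed

end
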